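(* Let $X$ and $Y$ be random variables, each of which may be continuous or discrete, with copula density $\operatorname{cop}(u,v;X,Y)$. Then $$\operatorname{cop}(u,v;X,Y)-1=\sum_{j,k>0}\operatorname{LP}(j,k;X,Y)\,S_j(u;X)\,S_k(v;Y),\qquad 0<u,v<1.$$ Equivalently, $$\int_{[0,1]^2} du\,dv\; d(v;Y,Y|X=Q(u;X))\,S_j(u;X)\,S_k(v;Y)=\operatorname{LP}(j,k;X,Y).$$
   Context: Notation for a real random variable $X$: $F(x;X)=\Pr[X\le x]$; $p(x;X)=\Pr[X=x]$; $f(x;X)$ is the probability density when $X$ is continuous; the quantile function is $Q(u;X)=\inf\{x:F(x;X)\ge u\}$, $0<u<1$; the mid-distribution function is $F^{\mathrm{mid}}(x;X)=F(x;X)-\tfrac12 p(x;X)$. Score functions: $T_1(x;X)=\big(F^{\mathrm{mid}}(x;X)-\tfrac12\big)/\sigma\big(F^{\mathrm{mid}}(X;X)\big)$, where $\sigma$ denotes standard deviation, and the $T_j(x;X)$, with $T_0=1$, are obtained by Gram–Schmidt orthonormalization of the powers $1,T_1,T_1^2,\dots$ with respect to the inner product $\langle a,b\rangle=E[a(X)b(X)]$ (when $X$ takes finitely many values only finitely many score functions exist, and indices run over those). Put $S_j(u;X)=T_j(Q(u;X);X)$. The same definitions apply to $Y$. The LP comoments are $\operatorname{LP}(j,k;X,Y)=E[T_j(X;X)\,T_k(Y;Y)]$. Copula density: $\operatorname{cop}(u,v;X,Y)$ is the common value of the conditional comparison density of $Y$ given $X$, $d(v;Y,Y|X=Q(u;X))$,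 and the conditional comparison density of $X$ given $Y$, $d(u;X,X|Y=Q(v;Y))$. With $x=Q(u;X)$, $y=Q(v;Y)$, this common value is: - $f(x,y;X,Y)/\big(f(x;X)f(y;Y)\big)$ if $(X,Y)$ is jointly continuous with joint density $f(x,y;X,Y)$; - $\Pr[X=x,Y=y]/\big(\Pr[X=x]\Pr[Y=y]\big)$ if both are discrete; - $\Pr[Y=y|X=x]/\Pr[Y=y]=f(x;X|Y=y)/f(x;X)$ if $X$ is continuous and $Y$ is discrete, where $f(\cdot;X|Y=y)$ is the conditional density of $X$ given $Y=y$; and symmetrically if $X$ is discrete and $Y$ is continuous.
   Formalization: The series is proved not at every u,v but in mean square, exactly when cop is square integrable; for X, Y both discrete it is proved pointwise wherever Q(u;X), Q(v;Y) have positive probability; in every case the coefficients of cop−1 are identified. *)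

theory Defs
  imports "HOL-Probability.Probability"
begin

definition discrete_rv :: "'a measure \<Rightarrow> ('a \<Rightarrow> real) \<Rightarrow> bool" where
  "discrete_rv M X \<longleftrightarrow>
     X \<in> borel_measurable M \<and> (\<exists>A. countable A \<and> (AE \<omega> in M. X \<omega> \<in> A))"

text \<open>A real-valued version of the density of \<open>X\<close> with respect to \<open>N\<close>. Nonnegativity is
  required because \<^const>\<open>ennreal\<close> would truncate negative values to zero.\<close>

definition is_density :: "'a measure \<Rightarrow> 'b measure \<Rightarrow> ('a \<Rightarrow> 'b) \<Rightarrow> ('b \<Rightarrow> real) \<Rightarrow> bool" where
  "is_density M N X f \<longleftrightarrow> (\<forall>x. 0 \<le> f x) \<and> distributed M N X (\<lambda>x. ennreal (f x))"

definition quantile :: "'a measure \<Rightarrow> ('a \<Rightarrow> real) \<Rightarrow> real \<Rightarrow> real" where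
  "quantile M X u = Inf {x. u \<le> cdf (distr M borel X) x}"

definition mid_cdf :: "'a measure \<Rightarrow> ('a \<Rightarrow> real) \<Rightarrow> real \<Rightarrow> real" where
  "mid_cdf M X x = cdf (distr M borel X) x - \<P>(\<omega> in M. X \<omega> = x) / 2"

definition std_dev :: "'a measure \<Rightarrow> ('a \<Rightarrow> real) \<Rightarrow> real" where
  "std_dev M Z = sqrt (prob_space.variance M Z)"

text \<open>Gram--Schmidt orthonormalization of a sequence \<open>p\<close> with respect to an inner product \<open>ip\<close>.
  If the \<open>j\<close>-th residual has norm zero, \<open>p j\<close> contributes no new vector.\<close>

definition normalized :: "(('b \<Rightarrow> real) \<Rightarrow> ('b \<Rightarrow> real) \<Rightarrow> real) \<Rightarrow> ('b \<Rightarrow> real) \<Rightarrow> 'b \<Rightarrow> real" where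
  "normalized ip r = (\<lambda>x. r x / sqrt (ip r r))"

fun gs_residual ::
  "(('b \<Rightarrow> real) \<Rightarrow> ('b \<Rightarrow> real) \<Rightarrow> real) \<Rightarrow> (nat \<Rightarrow> 'b \<Rightarrow> real) \<Rightarrow> nat \<Rightarrow> 'b \<Rightarrow> real" where
  "gs_residual ip p j =
     (\<lambda>x. p j x - (\<Sum>i<j. ip (p j) (normalized ip (gs_residual ip p i))
                          * normalized ip (gs_residual ip p i) x))"

declare gs_residual.simps [simp del]

definition score_inner ::
  "'a measure \<Rightarrow> ('a \<Rightarrow> real) \<Rightarrow> (real \<Rightarrow> real) \<Rightarrow> (real \<Rightarrow> real) \<Rightarrow> real" where
  "score_inner M X a b = (\<integral>\<omega>. a (X \<omega>) * b (X \<omega>) \<partial>M)"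

definition first_score :: "'a measure \<Rightarrow> ('a \<Rightarrow> real) \<Rightarrow> real \<Rightarrow> real" where
  "first_score M X x = (mid_cdf M X x - 1/2) / std_dev M (\<lambda>\<omega>. mid_cdf M X (X \<omega>))"

definition score_residual :: "'a measure \<Rightarrow> ('a \<Rightarrow> real) \<Rightarrow> nat \<Rightarrow> real \<Rightarrow> real" where
  "score_residual M X = gs_residual (score_inner M X) (\<lambda>j x. first_score M X x ^ j)"

definition score :: "'a measure \<Rightarrow> ('a \<Rightarrow> real) \<Rightarrow> nat \<Rightarrow> real \<Rightarrow> real" where
  "score M X j = normalized (score_inner M X) (score_residual M X j)"

text \<open>The indices \<open>j\<close> for which a score function exists: all of them, unless \<open>X\<close> takes only
  finitely many values, say \<open>m\<close>, in which case Gram--Schmidt stops after \<open>j = m - 1\<close>.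
  For almost surely constant \<open>X\<close>, where \<open>first_score\<close> is a division by zero, only
  \<open>j = 0\<close> is left.\<close>

definition score_index :: "'a measure \<Rightarrow> ('a \<Rightarrow> real) \<Rightarrow> nat set" where
  "score_index M X = {j. score_inner M X (score_residual M X j) (score_residual M X j) \<noteq> 0}"

definition quantile_score :: "'a measure \<Rightarrow> ('a \<Rightarrow> real) \<Rightarrow> nat \<Rightarrow> real \<Rightarrow> real" where
  "quantile_score M X j u = score M X j (quantile M X u)"

definition LP_comoment ::
  "'a measure \<Rightarrow> nat \<Rightarrow> nat \<Rightarrow> ('a \<Rightarrow> real) \<Rightarrow> ('a \<Rightarrow> real) \<Rightarrow> real" where
  "LP_comoment M j k X Y = (\<integral>\<omega>. score M X j (X \<omega>) * score M Y k (Y \<omega>) \<partial>M)"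

text \<open>\<open>cond_comparison_density M X Y d\<close>: the function \<open>d v x\<close> is a version of
  \<open>d(v; Y, Y|X=x)\<close>, the conditional density (or probability) of \<open>Y\<close> given \<open>X = x\<close> divided by the
  marginal density (or probability) of \<open>Y\<close>, both taken at the quantile \<open>Q(v; Y)\<close>. Densities, and
  conditional probabilities given a continuous \<open>X\<close>, are determined only almost everywhere, so
  this is a predicate rather than a function of \<open>X\<close> and \<open>Y\<close>.\<close>

inductive cond_comparison_density ::
  "'a measure \<Rightarrow> ('a \<Rightarrow> real) \<Rightarrow> ('a \<Rightarrow> real) \<Rightarrow> (real \<Rightarrow> real \<Rightarrow> real) \<Rightarrow> bool"
  for M X Y where
  continuous_continuous:
    "is_density M (lborel \<Otimes>\<^sub>M lborel) (\<lambda>\<omega>. (X \<omega>, Y \<omega>)) f \<Longrightarrow>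
     is_density M lborel X fX \<Longrightarrow> is_density M lborel Y fY \<Longrightarrow>
     cond_comparison_density M X Y
       (\<lambda>v x. (f (x, quantile M Y v) / fX x) / fY (quantile M Y v))"
| discrete_discrete:
    "discrete_rv M X \<Longrightarrow> discrete_rv M Y \<Longrightarrow>
     cond_comparison_density M X Y
       (\<lambda>v x. \<P>(\<omega> in M. Y \<omega> = quantile M Y v \<bar> X \<omega> = x) / \<P>(\<omega> in M. Y \<omega> = quantile M Y v))"
| continuous_discrete:
    "is_density M lborel X fX \<Longrightarrow> discrete_rv M Y \<Longrightarrow>
     (\<And>y. g y \<in> borel_measurable borel) \<Longrightarrow>
     (\<And>y. AE \<omega> in M. g y (X \<omega>) =
        real_cond_exp M (vimage_algebra (space M) X borel)
          (indicator {\<omega> \<in> space M. Y \<omega> = y}) \<omega>) \<Longrightarrow>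
     cond_comparison_density M X Y
       (\<lambda>v x. g (quantile M Y v) x / \<P>(\<omega> in M. Y \<omega> = quantile M Y v))"
| discrete_continuous:
    "discrete_rv M X \<Longrightarrow> is_density M lborel Y fY \<Longrightarrow>
     (\<And>x. \<P>(\<omega> in M. X \<omega> = x) \<noteq> 0 \<Longrightarrow>
        is_density (uniform_measure M {\<omega> \<in> space M. X \<omega> = x}) lborel Y (h x)) \<Longrightarrow>
     cond_comparison_density M X Y
       (\<lambda>v x. h x (quantile M Y v) / fY (quantile M Y v))"

definition is_copula_density ::
  "'a measure \<Rightarrow> ('a \<Rightarrow> real) \<Rightarrow> ('a \<Rightarrow> real) \<Rightarrow>
   (real \<Rightarrow> real \<Rightarrow> real) \<Rightarrow> (real \<Rightarrow> real \<Rightarrow> real) \<Rightarrow> (real \<Rightarrow> real \<Rightarrow> real) \<Rightarrow> bool" where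
  "is_copula_density M X Y dY dX cop \<longleftrightarrow>
     cond_comparison_density M X Y dY \<and> cond_comparison_density M Y X dX \<and>
     (\<forall>u v. 0 < u \<and> u < 1 \<and> 0 < v \<and> v < 1 \<longrightarrow>
        cop u v = dY v (quantile M X u) \<and> cop u v = dX u (quantile M Y v))"

text \<open>The boundary is left out: it has measure zero, and quantile functions are defined only
  on the open unit interval.\<close>

abbreviation unit_square :: "(real \<times> real) set" where
  "unit_square \<equiv> {0<..<1} \<times> {0<..<1}"

definition has_L2_sum ::
  "('i \<Rightarrow> real \<times> real \<Rightarrow> real) \<Rightarrow> 'i set \<Rightarrow> (real \<times> real \<Rightarrow> real) \<Rightarrow> bool" where
  "has_L2_sum f I g \<longleftrightarrow>
     ((\<lambda>F. \<integral>\<^sup>+z\<in>unit_square. ennreal ((g z - (\<Sum>i\<in>F. f i z))\<^sup>2) \<partial>lborel) \<longlongrightarrow> 0)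
       (finite_subsets_at_top I)"

end

theory Submission
  imports Defs
begin

text \<open>Let \<open>\<mu>\<close> and \<open>\<nu>\<close> be the laws of \<open>X\<close> and \<open>Y\<close>. In all cases \<open>cop u v = c (Q u, Q v)\<close>, where \<open>c\<close> is
  the density of the joint law with respect to \<open>\<mu> \<Otimes> \<nu>\<close>, and the pair of quantile functions maps
  the uniform distribution on the unit square to \<open>\<mu> \<Otimes> \<nu>\<close>; so the coefficient of \<open>cop\<close> at
  \<open>S\<^sub>j \<otimes> S\<^sub>k\<close> is \<open>E[T\<^sub>j(X) T\<^sub>k(Y)]\<close>. The products \<open>T\<^sub>j \<otimes> T\<^sub>k\<close> are complete in \<open>L\<^sup>2(\<mu> \<Otimes> \<nu>)\<close>: up to a
  null set the event \<open>X \<le> a\<close> says \<open>T\<^sub>1(X) \<le> t\<close>, whose indicator is a bounded limit of polynomials in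
  the bounded function \<open>T\<^sub>1\<close>. At atoms \<open>x\<close>, \<open>y\<close> the partial sums of the series are
  \<open>E[K\<^sub>m(x, X) K\<^sub>n(y, Y)]\<close> with the reproducing kernels \<open>K\<^sub>m(x, t) = \<Sum>\<^sub>j T\<^sub>j(x) T\<^sub>j(t)\<close>, which converge
  in mean square to \<open>1{t = x} / Pr[X = x]\<close>.\<close>

subsection \<open>Square-integrable functions and orthonormal expansions\<close>

text \<open>Everything rests on \<open>T_1\<close> being bounded. Bounded scores are square
  integrable under any law, and polynomials in a bounded variable are dense by Weierstrass, with no
  moment problem to exclude. Moreover the coefficients of \<open>cop\<close> exist for every copula
  density, although \<open>cop\<close> itself is only integrable and may fail to be square
  integrable. Mean-square convergence therefore appears as an equivalence: the partial sums are
  bounded, so a function at finite distance from one of them is square integrable itself.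

  \<open>T_1\<close> determines \<open>X\<close> only up to null sets, and it degenerates to a
  division by zero when \<open>X\<close> is almost surely constant. Functions are hence compared
  almost everywhere, and indices at which Gram-Schmidt produces nothing are carried along as zero
  functions.

  The other obstacle is that the given versions of \<open>cop\<close> may be fixed only almost
  everywhere. Single values mean something only at pairs of atoms. Evaluation at an atom is
  continuous in mean square; applied to each variable separately, this yields a pointwise limit even
  when \<open>cop\<close> is not square integrable.\<close>

definition L2_fun :: "'b measure \<Rightarrow> ('b \<Rightarrow> real) \<Rightarrow> bool" where
  "L2_fun N f \<longleftrightarrow> f \<in> borel_measurable N \<and> integrable N (\<lambda>x. (f x)\<^sup>2)"

definition sq_dist :: "'b measure \<Rightarrow> ('b \<Rightarrow> real) \<Rightarrow> ('b \<Rightarrow> real) \<Rightarrow> real" where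
  "sq_dist N f g = (\<integral>x. (f x - g x)\<^sup>2 \<partial>N)"

text \<open>Square integrability of \<open>g\<close> is a separate condition: the Bochner integral
  in \<open>sq_dist\<close> is 0 when the square is not integrable, so a wild \<open>g\<close> would
  otherwise seem to have distance 0 from every combination.\<close>

definition L2_span_closure ::
  "'b measure \<Rightarrow> ('i \<Rightarrow> 'b \<Rightarrow> real) \<Rightarrow> 'i set \<Rightarrow> ('b \<Rightarrow> real) set" where
  "L2_span_closure N e I = {g. L2_fun N g \<and>
     (\<forall>\<epsilon>>0. \<exists>F a. finite F \<and> F \<subseteq> I \<and> sq_dist N g (\<lambda>x. \<Sum>i\<in>F. a i * e i x) < \<epsilon>)}"

lemma abs_mult_le_sum_squares: "\<bar>a * b\<bar> \<le> a\<^sup>2 + (b :: real)\<^sup>2"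
proof -
  have "0 \<le> (\<bar>a\<bar> - \<bar>b\<bar>)\<^sup>2" by simp
  then show ?thesis unfolding power2_diff power2_abs abs_mult
    using mult_nonneg_nonneg[of "\<bar>a\<bar>" "\<bar>b\<bar>"] by linarith
qed

lemma L2_fun_mult_integrable:
  assumes "L2_fun N f" "L2_fun N g"
  shows "integrable N (\<lambda>x. f x * g x)"
proof (rule Bochner_Integration.integrable_bound)
  show "integrable N (\<lambda>x. (f x)\<^sup>2 + (g x)\<^sup>2)"
    using assms by (simp add: L2_fun_def)
  show "(\<lambda>x. f x * g x) \<in> borel_measurable N"
    using assms by (auto simp: L2_fun_def intro: borel_measurable_times)
  show "AE x in N. norm (f x * g x) \<le> norm ((f x)\<^sup>2 + (g x)\<^sup>2)"
    using abs_mult_le_sum_squares by simp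
qed

lemma L2_fun_add:
  assumes "L2_fun N f" "L2_fun N g"
  shows "L2_fun N (\<lambda>x. f x + g x)"
  using assms L2_fun_mult_integrable[OF assms]
  by (auto simp: L2_fun_def power2_sum mult.assoc)

lemma L2_fun_cmult: "L2_fun N f \<Longrightarrow> L2_fun N (\<lambda>x. c * f x)"
  by (auto simp: L2_fun_def power_mult_distrib)

lemma L2_fun_diff: "L2_fun N f \<Longrightarrow> L2_fun N g \<Longrightarrow> L2_fun N (\<lambda>x. f x - g x)"
  using L2_fun_add[of N f "\<lambda>x. (-1) * g x"] L2_fun_cmult[of N g "-1"] by simp

lemma L2_fun_zero: "L2_fun N (\<lambda>x. 0)"
  by (simp add: L2_fun_def)

lemma L2_fun_sum: "(\<And>i. i \<in> F \<Longrightarrow> L2_fun N (f i)) \<Longrightarrow> L2_fun N (\<lambda>x. \<Sum>i\<in>F. f i x)"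
  by (induction F rule: infinite_finite_induct) (auto simp: L2_fun_zero L2_fun_add)

lemma L2_fun_bounded:
  assumes "finite_measure N" "f \<in> borel_measurable N" "AE x in N. \<bar>f x\<bar> \<le> C"
  shows "L2_fun N f"
proof -
  interpret finite_measure N by fact
  have "integrable N (\<lambda>x. (f x)\<^sup>2)"
  proof (rule integrable_const_bound)
    show "AE x in N. norm ((f x)\<^sup>2) \<le> C\<^sup>2"
      using assms(3) by eventually_elim (simp add: abs_le_square_iff[symmetric])
  qed (use assms(2) in simp)
  then show ?thesis using assms(2) by (simp add: L2_fun_def)
qed

lemma sq_dist_nonneg: "0 \<le> sq_dist N f g"
  by (simp add: sq_dist_def)

lemma sq_dist_integrable:
  assumes "L2_fun N f" "L2_fun N g"
  shows "integrable N (\<lambda>x. (f x - g x)\<^sup>2)"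
  using L2_fun_diff[OF assms] by (simp add: L2_fun_def)

lemma sq_sum_le: "(a + b)\<^sup>2 \<le> 2 * a\<^sup>2 + 2 * (b::real)\<^sup>2"
proof -
  have "0 \<le> (a - b)\<^sup>2" by simp
  then show ?thesis by (simp add: power2_diff power2_sum)
qed

text \<open>With squared distances, Minkowski's inequality is replaced by
  \<open>(a + b)^2 \<le> 2 a^2 + 2 b^2\<close> under the integral. The lost factor 2 does no harm to
  closure arguments, and square roots are avoided.\<close>

lemma sq_dist_triangle:
  assumes "L2_fun N f" "L2_fun N g" "L2_fun N h"
  shows "sq_dist N f h \<le> 2 * sq_dist N f g + 2 * sq_dist N g h"
proof -
  have "sq_dist N f h \<le> (\<integral>x. 2 * (f x - g x)\<^sup>2 + 2 * (g x - h x)\<^sup>2 \<partial>N)"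
    unfolding sq_dist_def
  proof (rule integral_mono)
    show "(f x - h x)\<^sup>2 \<le> 2 * (f x - g x)\<^sup>2 + 2 * (g x - h x)\<^sup>2" for x
      using sq_sum_le[of "f x - g x" "g x - h x"] by simp
  qed (use assms in \<open>simp_all add: sq_dist_integrable\<close>)
  also have "\<dots> = 2 * sq_dist N f g + 2 * sq_dist N g h"
    using assms by (simp add: sq_dist_def sq_dist_integrable)
  finally show ?thesis .
qed

lemma sq_dist_add:
  assumes "L2_fun N f" "L2_fun N g" "L2_fun N f'" "L2_fun N g'"
  shows "sq_dist N (\<lambda>x. f x + g x) (\<lambda>x. f' x + g' x) \<le> 2 * sq_dist N f f' + 2 * sq_dist N g g'"
proof -
  have "sq_dist N (\<lambda>x. f x + g x) (\<lambda>x. f' x + g' x)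
     \<le> (\<integral>x. 2 * (f x - f' x)\<^sup>2 + 2 * (g x - g' x)\<^sup>2 \<partial>N)"
    unfolding sq_dist_def
  proof (rule integral_mono)
    show "(f x + g x - (f' x + g' x))\<^sup>2 \<le> 2 * (f x - f' x)\<^sup>2 + 2 * (g x - g' x)\<^sup>2" for x
      using sq_sum_le[of "f x - f' x" "g x - g' x"] by (simp add: algebra_simps)
  qed (use assms in \<open>simp_all add: sq_dist_integrable L2_fun_add\<close>)
  also have "\<dots> = 2 * sq_dist N f f' + 2 * sq_dist N g g'"
    using assms by (simp add: sq_dist_def sq_dist_integrable)
  finally show ?thesis .
qed

section \<open>Closed linear span of a family of square-integrable functions\<close>

locale L2_family =
  fixes N :: "'b measure" and e :: "'i \<Rightarrow> 'b \<Rightarrow> real" and I :: "'i set"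
  assumes L2: "i \<in> I \<Longrightarrow> L2_fun N (e i)"
begin

abbreviation "cl \<equiv> L2_span_closure N e I"

lemma lincomb_L2: "F \<subseteq> I \<Longrightarrow> L2_fun N (\<lambda>x. \<Sum>i\<in>F. a i * e i x)"
  by (auto intro!: L2_fun_sum L2_fun_cmult L2)

lemma closure_L2: "g \<in> cl \<Longrightarrow> L2_fun N g"
  by (simp add: L2_span_closure_def)

lemma closure_limit:
  assumes "\<And>n::nat. f n \<in> cl" "L2_fun N g" "(\<lambda>n. sq_dist N g (f n)) \<longlonglongrightarrow> 0"
  shows "g \<in> cl"
  unfolding L2_span_closure_def
proof (intro CollectI conjI allI impI)
  fix \<epsilon> :: real assume "\<epsilon> > 0"
  \<comment> \<open>Two distances below \<open>\<epsilon> / 4\<close>, each doubled by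
    \<open>sq_dist_triangle\<close>, add up to less than \<open>\<epsilon>\<close>.\<close>
  then have "eventually (\<lambda>n. sq_dist N g (f n) < \<epsilon> / 4) sequentially"
    using assms(3) by (intro order_tendstoD(2)) auto
  then obtain n where n: "sq_dist N g (f n) < \<epsilon> / 4"
    by (auto simp: eventually_sequentially)
  obtain F a where F: "finite F" "F \<subseteq> I"
      "sq_dist N (f n) (\<lambda>x. \<Sum>i\<in>F. a i * e i x) < \<epsilon> / 4"
    using assms(1)[of n] \<open>\<epsilon> > 0\<close> unfolding L2_span_closure_def
    by (auto dest!: spec[of _ "\<epsilon> / 4"])
  have "sq_dist N g (\<lambda>x. \<Sum>i\<in>F. a i * e i x) < \<epsilon>"
    using sq_dist_triangle[OF assms(2) closure_L2[OF assms(1)] lincomb_L2[OF F(2), of a], of n] n F(3)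
    by linarith
  with F show "\<exists>F a. finite F \<and> F \<subseteq> I \<and> sq_dist N g (\<lambda>x. \<Sum>i\<in>F. a i * e i x) < \<epsilon>"
    by blast
qed fact

text \<open>The bridge from pointwise to mean-square limits, through which the later approximations
  enter the closure. Convergence is asked only almost everywhere, because half-lines are recovered
  from \<open>T_1\<close> only up to null sets.\<close>

lemma closure_dominated:
  assumes "\<And>n::nat. f n \<in> cl" and [measurable]: "g \<in> borel_measurable N" and "L2_fun N w"
    and lim: "AE x in N. (\<lambda>n. f n x) \<longlonglongrightarrow> g x" and bd: "\<And>n. AE x in N. \<bar>f n x\<bar> \<le> w x"
  shows "g \<in> cl"
proof -
  have [measurable]: "f n \<in> borel_measurable N" for n
    using closure_L2[OF assms(1)] by (simp add: L2_fun_def)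
  have [measurable]: "w \<in> borel_measurable N" and w2: "integrable N (\<lambda>x. (w x)\<^sup>2)"
    using assms(3) by (simp_all add: L2_fun_def)
  have all: "AE x in N. \<forall>n. \<bar>f n x\<bar> \<le> w x"
    using bd by (simp add: AE_all_countable)
  have gw: "AE x in N. \<bar>g x\<bar> \<le> w x"
    using all lim by eventually_elim (auto intro!: LIMSEQ_le_const2 tendsto_rabs)
  have "integrable N (\<lambda>x. (g x)\<^sup>2)"
    by (rule Bochner_Integration.integrable_bound[OF w2])
      (use gw in \<open>auto elim!: eventually_mono simp: abs_le_square_iff[symmetric]\<close>)
  then have g: "L2_fun N g" by (simp add: L2_fun_def)
  \<comment> \<open>Both \<open>g\<close> and \<open>f n\<close> are bounded by \<open>w\<close>, so
    their difference is at most \<open>2 w\<close> and its square at most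
    \<open>4 w^2\<close>.\<close>
  have "(\<lambda>n. \<integral>x. (g x - f n x)\<^sup>2 \<partial>N) \<longlonglongrightarrow> (\<integral>x. 0 \<partial>N)"
  proof (rule integral_dominated_convergence[where w="\<lambda>x. 4 * (w x)\<^sup>2"])
    show "AE x in N. (\<lambda>n. (g x - f n x)\<^sup>2) \<longlonglongrightarrow> 0"
      using lim
    proof eventually_elim
      case (elim x)
      have "(\<lambda>n. (g x - f n x)\<^sup>2) \<longlonglongrightarrow> (g x - g x)\<^sup>2"
        by (intro tendsto_intros elim)
      then show ?case by simp
    qed
    show "AE x in N. norm ((g x - f n x)\<^sup>2) \<le> 4 * (w x)\<^sup>2" for n
      using gw bd[of n]
    proof eventually_elim
      case (elim x)
      then have "\<bar>g x - f n x\<bar> \<le> \<bar>2 * w x\<bar>" by linarith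
      then have "(g x - f n x)\<^sup>2 \<le> (2 * w x)\<^sup>2" by (simp only: abs_le_square_iff)
      then show ?case by (simp add: power_mult_distrib)
    qed
  qed (use w2 in simp_all)
  then show ?thesis
    by (intro closure_limit[OF assms(1) g]) (simp add: sq_dist_def)
qed

text \<open>Dominated convergence for the constant sequence \<open>f\<close>, with
  \<open>\<bar>f\<bar>\<close> as the dominating function.\<close>

lemma closure_AE_cong:
  assumes "f \<in> cl" "g \<in> borel_measurable N" "AE x in N. f x = g x"
  shows "g \<in> cl"
proof (rule closure_dominated[where f="\<lambda>n. f" and w="\<lambda>x. \<bar>f x\<bar>"])
  show "L2_fun N (\<lambda>x. \<bar>f x\<bar>)"
    using closure_L2[OF assms(1)] by (auto simp: L2_fun_def intro: borel_measurable_abs)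
qed (use assms in auto)

lemma closure_lincomb:
  assumes "finite F" "F \<subseteq> I"
  shows "(\<lambda>x. \<Sum>i\<in>F. a i * e i x) \<in> cl"
  unfolding L2_span_closure_def using assms lincomb_L2[OF assms(2)]
  by (auto intro!: exI[of _ F] exI[of _ a] simp: sq_dist_def)

lemma closure_add:
  assumes "f \<in> cl" "g \<in> cl"
  shows "(\<lambda>x. f x + g x) \<in> cl"
  unfolding L2_span_closure_def
proof (intro CollectI conjI allI impI)
  show "L2_fun N (\<lambda>x. f x + g x)"
    using assms by (intro L2_fun_add closure_L2)
  fix \<epsilon> :: real assume "\<epsilon> > 0"
  then obtain F a where F: "finite F" "F \<subseteq> I" "sq_dist N f (\<lambda>x. \<Sum>i\<in>F. a i * e i x) < \<epsilon> / 4"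
    using assms(1) unfolding L2_span_closure_def by (auto dest!: spec[of _ "\<epsilon> / 4"])
  obtain G b where G: "finite G" "G \<subseteq> I" "sq_dist N g (\<lambda>x. \<Sum>i\<in>G. b i * e i x) < \<epsilon> / 4"
    using assms(2) \<open>\<epsilon> > 0\<close> unfolding L2_span_closure_def by (auto dest!: spec[of _ "\<epsilon> / 4"])
  \<comment> \<open>The coefficients of the two combinations are extended by 0 to the union, so that
    they add even where the index sets overlap.\<close>
  define d where "d i = (if i \<in> F then a i else 0) + (if i \<in> G then b i else 0)" for i
  have "(\<Sum>i\<in>F \<union> G. d i * e i x) = (\<Sum>i\<in>F. a i * e i x) + (\<Sum>i\<in>G. b i * e i x)" for x
  proof -
    have "(\<Sum>i\<in>F \<union> G. d i * e i x)
        = (\<Sum>i\<in>F \<union> G. (if i \<in> F then a i * e i x else 0) + (if i \<in> G then b i * e i x else 0))"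
      by (intro sum.cong) (auto simp: d_def algebra_simps)
    also have "\<dots> = (\<Sum>i\<in>F. a i * e i x) + (\<Sum>i\<in>G. b i * e i x)"
      using F(1) G(1) by (simp add: sum.distrib sum.If_cases Int_absorb1 Int_absorb2)
    finally show ?thesis .
  qed
  then have "sq_dist N (\<lambda>x. f x + g x) (\<lambda>x. \<Sum>i\<in>F \<union> G. d i * e i x) < \<epsilon>"
    using sq_dist_add[OF assms[THEN closure_L2] lincomb_L2[OF F(2), of a] lincomb_L2[OF G(2), of b]]
      F(3) G(3) by simp
  with F G show "\<exists>F a. finite F \<and> F \<subseteq> I \<and> sq_dist N (\<lambda>x. f x + g x) (\<lambda>x. \<Sum>i\<in>F. a i * e i x) < \<epsilon>"
    by (intro exI[of _ "F \<union> G"] exI[of _ d]) auto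
qed

lemma closure_cmult:
  assumes "f \<in> cl"
  shows "(\<lambda>x. c * f x) \<in> cl"
  unfolding L2_span_closure_def
proof (intro CollectI conjI allI impI)
  show "L2_fun N (\<lambda>x. c * f x)"
    using assms by (intro L2_fun_cmult closure_L2)
  fix \<epsilon> :: real assume "\<epsilon> > 0"
  \<comment> \<open>\<open>c^2 + 1\<close> instead of \<open>c^2\<close> keeps the denominator
    positive for \<open>c = 0\<close>.\<close>
  have "0 < \<epsilon> / (c\<^sup>2 + 1)" using \<open>\<epsilon> > 0\<close> by (simp add: add_nonneg_pos)
  then obtain F a where F: "finite F" "F \<subseteq> I"
      "sq_dist N f (\<lambda>x. \<Sum>i\<in>F. a i * e i x) < \<epsilon> / (c\<^sup>2 + 1)"
    using assms(1) unfolding L2_span_closure_def by blast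
  have "(c * f x - (\<Sum>i\<in>F. c * a i * e i x))\<^sup>2 = c\<^sup>2 * (f x - (\<Sum>i\<in>F. a i * e i x))\<^sup>2" for x
    by (simp add: sum_distrib_left[symmetric] mult.assoc right_diff_distrib[symmetric] power_mult_distrib)
  then have "sq_dist N (\<lambda>x. c * f x) (\<lambda>x. \<Sum>i\<in>F. c * a i * e i x)
      = c\<^sup>2 * sq_dist N f (\<lambda>x. \<Sum>i\<in>F. a i * e i x)"
    by (simp add: sq_dist_def)
  also have "\<dots> \<le> (c\<^sup>2 + 1) * sq_dist N f (\<lambda>x. \<Sum>i\<in>F. a i * e i x)"
    by (simp add: sq_dist_nonneg mult_right_mono)
  also have "\<dots> < \<epsilon>"
    using F(3) by (simp add: field_simps add_pos_nonneg)
  finally show "\<exists>F a. finite F \<and> F \<subseteq> I \<and> sq_dist N (\<lambda>x. c * f x) (\<lambda>x. \<Sum>i\<in>F. a i * e i x) < \<epsilon>"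
    using F(1,2) by (intro exI[of _ F] exI[of _ "\<lambda>i. c * a i"]) simp
qed

lemma closure_diff: "f \<in> cl \<Longrightarrow> g \<in> cl \<Longrightarrow> (\<lambda>x. f x - g x) \<in> cl"
  using closure_add[of f "\<lambda>x. (-1) * g x"] closure_cmult[of g "-1"] by simp

lemma closure_zero: "(\<lambda>x. 0) \<in> cl"
  using closure_lincomb[of "{}"] by simp

lemma closure_sum: "(\<And>i. i \<in> F \<Longrightarrow> f i \<in> cl) \<Longrightarrow> (\<lambda>x. \<Sum>i\<in>F. f i x) \<in> cl"
  by (induction F rule: infinite_finite_induct) (auto simp: closure_zero closure_add)

end

section \<open>Completeness from indicators of lower orthants, on the line and in the plane\<close>

locale dense_indicators = L2_family N e I + finite_measure N
  for N :: "'b::ordered_euclidean_space measure" and e :: "'i \<Rightarrow> 'b \<Rightarrow> real" and I +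
  assumes sets_N: "sets N = sets borel"
    and one: "(\<lambda>x. 1) \<in> L2_span_closure N e I"
    and atMost: "indicator {..a} \<in> L2_span_closure N e I"
begin

text \<open>Dynkin's argument: the orthants \<open>{..a}\<close> are stable under intersection and
  generate the Borel sets, while the sets with indicator in the closure admit complements, by
  \<open>one\<close>, and countable disjoint unions, by dominated convergence with bound 1.\<close>

lemma indicator_in_closure:
  assumes "A \<in> sets N"
  shows "indicator A \<in> cl"
proof -
  let ?G = "range (\<lambda>a. {..a::'b})"
  have eq: "sets N = sigma_sets UNIV ?G"
    unfolding sets_N by (subst borel_eq_atMost) (rule sets_measure_of, simp)
  have A: "A \<in> sigma_sets UNIV ?G"
    using assms eq by blast
  have sub: "B \<in> sigma_sets UNIV ?G \<Longrightarrow> B \<in> sets N" for B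
    using eq by blast
  have "Int_stable ?G"
  proof (unfold Int_stable_def, safe)
    fix a b :: 'b
    have "{..a} \<inter> {..b} = {..inf a b}" by auto
    then show "{..a} \<inter> {..b} \<in> ?G" by blast
  qed
  moreover have "?G \<subseteq> Pow UNIV" by simp
  ultimately show ?thesis using A
  proof (rule sigma_sets_induct_disjoint[where P="\<lambda>A. indicator A \<in> cl"], goal_cases)
    case (1 A)
    then show ?case using atMost by auto
  next
    case 2
    have "(indicator {} :: 'b \<Rightarrow> real) = (\<lambda>x. 0)" by auto
    then show ?case using closure_zero by simp
  next
    case (3 A)
    have "(indicator (UNIV - A) :: 'b \<Rightarrow> real) = (\<lambda>x. 1 - indicator A x)"
      by (auto simp: indicator_def)
    then show ?case using closure_diff[OF one 3(2)] by simp
  next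
    case (4 A)
    have [measurable]: "A i \<in> sets N" for i using 4(2) sub by auto
    have eq: "(\<Sum>i<n. indicator (A i) x) = (indicator (\<Union>i<n. A i) x :: real)" for n x
      using 4(1) by (subst indicator_UN_disjoint)
         (auto simp: disjoint_family_on_def)
    show ?case
    proof (rule closure_dominated[where f="\<lambda>n x. \<Sum>i<n. indicator (A i) x" and w="\<lambda>x. 1"])
      show "(\<lambda>x. \<Sum>i<n. indicator (A i) x :: real) \<in> cl" for n
        using 4(3) by (intro closure_sum)
      show "L2_fun N (\<lambda>x. 1)" by (rule closure_L2[OF one])
      show "AE x in N. (\<lambda>n. \<Sum>i<n. indicator (A i) x :: real) \<longlonglongrightarrow> indicator (\<Union>i. A i) x"
        unfolding eq by (intro AE_I2 LIMSEQ_indicator_UN)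
      show "AE x in N. \<bar>\<Sum>i<n. indicator (A i) x :: real\<bar> \<le> 1" for n
        unfolding eq by (auto simp: indicator_def)
    qed simp
  qed
qed

text \<open>Square integrability stands inside the conclusion, because the induction over
  nonnegative measurable functions also passes through functions that are not square
  integrable.\<close>

lemma nonneg_in_closure:
  assumes "u \<in> borel_measurable N" "\<And>x. 0 \<le> u x"
  shows "L2_fun N u \<longrightarrow> u \<in> cl"
  using assms
proof (induction rule: borel_measurable_induct_real)
  case (set A)
  then show ?case by (simp add: indicator_in_closure)
next
  case (mult u c)
  show ?case
  \<comment> \<open>For \<open>c = 0\<close> the product is square integrable whatever
    \<open>u\<close> is, and the induction hypothesis says nothing; the product is then the zero
    function.\<close>
  proof (cases "c = 0")
    case False
    then have "L2_fun N u" if "L2_fun N (\<lambda>x. c * u x)"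
      using L2_fun_cmult[OF that, of "inverse c"] by (simp add: mult.assoc[symmetric])
    then show ?thesis using mult closure_cmult by blast
  qed (simp add: closure_zero)
next
  case (add u v)
  \<comment> \<open>Nonnegative summands lie below the sum, so they inherit square integrability
    from it.\<close>
  have *: "L2_fun N f" if "L2_fun N g" "f \<in> borel_measurable N" "\<And>x. 0 \<le> f x" "\<And>x. f x \<le> g x" for f g
  proof -
    have "integrable N (\<lambda>x. (f x)\<^sup>2)"
      by (rule Bochner_Integration.integrable_bound[where f="\<lambda>x. (g x)\<^sup>2"])
        (use that in \<open>auto simp: L2_fun_def intro!: power_mono\<close>)
    with that show ?thesis by (simp add: L2_fun_def)
  qed
  show ?case
  proof
    assume l: "L2_fun N (\<lambda>x. v x + u x)"
    have "L2_fun N u" "L2_fun N v"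
      by (rule *[OF l]; use add in simp)+
    then show "(\<lambda>x. v x + u x) \<in> cl" using add by (intro closure_add) auto
  qed
next
  case (seq U)
  have le: "U i x \<le> u x" if "x \<in> space N" for i x
    using seq(3,4) that by (intro incseq_le[of "\<lambda>i. U i x"]) (auto simp: incseq_def le_fun_def)
  show ?case
  proof
    assume l: "L2_fun N u"
    show "u \<in> cl"
    proof (rule closure_dominated[where f=U and w=u])
      show "U n \<in> cl" for n
      proof -
        have "integrable N (\<lambda>x. (U n x)\<^sup>2)"
          by (rule Bochner_Integration.integrable_bound[where f="\<lambda>x. (u x)\<^sup>2"])
            (use l seq(1,2) le in \<open>auto simp: L2_fun_def intro!: power_mono AE_I2\<close>)
        then show ?thesis using seq(1,5) by (auto simp: L2_fun_def)
      qed
    qed (use l le seq(2,4) in \<open>auto simp: L2_fun_def\<close>)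
  qed
qed

lemma L2_in_closure:
  assumes "L2_fun N g"
  shows "g \<in> cl"
proof -
  have [measurable]: "g \<in> borel_measurable N" and g2: "integrable N (\<lambda>x. (g x)\<^sup>2)"
    using assms by (auto simp: L2_fun_def)
  have "L2_fun N (\<lambda>x. max 0 (s * g x))" if "\<bar>s\<bar> = 1" for s
  proof -
    have "\<bar>max 0 (s * g x)\<bar> \<le> \<bar>g x\<bar>" for x
      using abs_mult[of s "g x"] that by (auto simp: max_def)
    then have "integrable N (\<lambda>x. (max 0 (s * g x))\<^sup>2)"
      by (intro Bochner_Integration.integrable_bound[OF g2])
        (measurable, simp add: abs_le_square_iff[symmetric])
    then show ?thesis by (simp add: L2_fun_def)
  qed
  from this[of 1] this[of "-1"] have "(\<lambda>x. max 0 (g x) - max 0 (- g x)) \<in> cl"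
    using nonneg_in_closure[of "\<lambda>x. max 0 (g x)"] nonneg_in_closure[of "\<lambda>x. max 0 (- g x)"]
    by (intro closure_diff) auto
  also have "(\<lambda>x. max 0 (g x) - max 0 (- g x)) = g" by (auto simp: max_def)
  finally show ?thesis .
qed

end

section \<open>Fourier series with respect to an orthonormal family\<close>

locale orthonormal_family = L2_family N e I
  for N :: "'b measure" and e :: "'i \<Rightarrow> 'b \<Rightarrow> real" and I +
  assumes orthonormal: "i \<in> I \<Longrightarrow> j \<in> I \<Longrightarrow> (\<integral>x. e i x * e j x \<partial>N) = (if i = j then 1 else 0)"
begin

text \<open>Completing the square in the coefficients. The last sum vanishes exactly when every
  \<open>a i\<close> is the Fourier coefficient, so these are optimal on \<open>F\<close>; what
  remains is Bessel's defect, which shrinks as \<open>F\<close> grows.\<close>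

lemma sq_dist_lincomb:
  assumes "L2_fun N g" "finite F" "F \<subseteq> I"
  shows "sq_dist N g (\<lambda>x. \<Sum>i\<in>F. a i * e i x)
    = (\<integral>x. (g x)\<^sup>2 \<partial>N) - (\<Sum>i\<in>F. (\<integral>x. g x * e i x \<partial>N)\<^sup>2)
      + (\<Sum>i\<in>F. (a i - (\<integral>x. g x * e i x \<partial>N))\<^sup>2)"
proof -
  let ?c = "\<lambda>i. \<integral>x. g x * e i x \<partial>N"
  have I1: "integrable N (\<lambda>x. g x * e i x)" if "i \<in> F" for i
    using that assms by (intro L2_fun_mult_integrable L2) auto
  have I2: "integrable N (\<lambda>x. e i x * e j x)" if "i \<in> F" "j \<in> F" for i j
    using that assms by (intro L2_fun_mult_integrable L2) auto
  have "(g x - (\<Sum>i\<in>F. a i * e i x))\<^sup>2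
     = (g x)\<^sup>2 - 2 * (\<Sum>i\<in>F. a i * (g x * e i x)) + (\<Sum>i\<in>F. \<Sum>j\<in>F. a i * a j * (e i x * e j x))" for x
  proof -
    have "(\<Sum>i\<in>F. a i * e i x)\<^sup>2 = (\<Sum>i\<in>F. \<Sum>j\<in>F. a i * a j * (e i x * e j x))"
      unfolding power2_eq_square sum_product by (simp add: mult_ac)
    then show ?thesis unfolding power2_diff by (simp add: sum_distrib_left mult_ac)
  qed
  then have "sq_dist N g (\<lambda>x. \<Sum>i\<in>F. a i * e i x) = (\<integral>x. (g x)\<^sup>2 \<partial>N)
     - 2 * (\<Sum>i\<in>F. a i * ?c i) + (\<Sum>i\<in>F. \<Sum>j\<in>F. a i * a j * (\<integral>x. e i x * e j x \<partial>N))"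
    using assms(1) I1 I2 by (simp add: sq_dist_def L2_fun_def)
  also have "(\<Sum>i\<in>F. \<Sum>j\<in>F. a i * a j * (\<integral>x. e i x * e j x \<partial>N)) = (\<Sum>i\<in>F. (a i)\<^sup>2)"
  proof (rule sum.cong[OF refl])
    fix i assume i: "i \<in> F"
    have "(\<Sum>j\<in>F. a i * a j * (\<integral>x. e i x * e j x \<partial>N)) = (\<Sum>j\<in>F. if i = j then a i * a j else 0)"
      using i assms(3) by (intro sum.cong) (auto simp: orthonormal subset_iff)
    also have "\<dots> = (a i)\<^sup>2" using i assms(2) by (simp add: power2_eq_square)
    finally show "(\<Sum>j\<in>F. a i * a j * (\<integral>x. e i x * e j x \<partial>N)) = (a i)\<^sup>2" .
  qed
  finally show ?thesis
    by (simp add: power2_diff sum.distrib sum_subtractf sum_distrib_left mult_ac)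
qed

text \<open>The smaller index set \<open>I0\<close> allows indices with vanishing coefficient to be
  left out of the sum: for \<open>cop - 1\<close> these are the pairs in which \<open>j\<close> or
  \<open>k\<close> is 0.\<close>

lemma fourier_series_converges:
  assumes "g \<in> cl" "I0 \<subseteq> I" "\<And>i. i \<in> I - I0 \<Longrightarrow> (\<integral>x. g x * e i x \<partial>N) = 0"
  shows "((\<lambda>F. sq_dist N g (\<lambda>x. \<Sum>i\<in>F. (\<integral>x. g x * e i x \<partial>N) * e i x)) \<longlongrightarrow> 0)
    (finite_subsets_at_top I0)"
proof (rule tendstoI)
  fix \<epsilon> :: real assume "0 < \<epsilon>"
  let ?c = "\<lambda>i. \<integral>x. g x * e i x \<partial>N"
  let ?S = "\<lambda>F. sq_dist N g (\<lambda>x. \<Sum>i\<in>F. ?c i * e i x)"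
  note g = closure_L2[OF assms(1)]
  have S: "?S F = (\<integral>x. (g x)\<^sup>2 \<partial>N) - (\<Sum>i\<in>F. (?c i)\<^sup>2)" if "finite F" "F \<subseteq> I" for F
    using sq_dist_lincomb[OF g that, of ?c] by simp
  obtain F a where F: "finite F" "F \<subseteq> I" "sq_dist N g (\<lambda>x. \<Sum>i\<in>F. a i * e i x) < \<epsilon>"
    using assms(1) \<open>0 < \<epsilon>\<close> unfolding L2_span_closure_def by auto
  \<comment> \<open>A finite \<open>G\<close> containing \<open>F \<inter> I0\<close> has at least
    the Bessel sum of \<open>F\<close>, and on \<open>F\<close> the Fourier coefficients do no worse
    than \<open>a\<close>.\<close>
  have "?S G < \<epsilon>" if G: "finite G" "F \<inter> I0 \<subseteq> G" "G \<subseteq> I0" for G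
  proof -
    have "(\<Sum>i\<in>F. (?c i)\<^sup>2) = (\<Sum>i\<in>F \<inter> I0. (?c i)\<^sup>2)"
      using F assms(3) by (intro sum.mono_neutral_right) auto
    also have "\<dots> \<le> (\<Sum>i\<in>G. (?c i)\<^sup>2)"
      using G by (intro sum_mono2) auto
    finally have "?S G \<le> ?S F"
      using S[of G] S[of F] G F assms(2) by auto
    also have "\<dots> \<le> sq_dist N g (\<lambda>x. \<Sum>i\<in>F. a i * e i x)"
      using sq_dist_lincomb[OF g F(1,2), of a] S[OF F(1,2)] by (simp add: sum_nonneg)
    also note F(3)
    finally show ?thesis .
  qed
  then show "\<forall>\<^sub>F G in finite_subsets_at_top I0. dist (?S G) 0 < \<epsilon>"
    using F(1)
    by (auto simp: eventually_finite_subsets_at_top sq_dist_nonneg intro!: exI[of _ "F \<inter> I0"])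
qed

end

subsection \<open>Mid-distribution and score functions\<close>

text \<open>Weierstrass cannot approximate the discontinuous step uniformly, so it is applied to
  steeper and steeper continuous ramps. Pointwise convergence with a uniform bound is all that
  dominated convergence asks for.\<close>

lemma polynomials_approach_step:
  fixes B t :: real
  obtains a :: "nat \<Rightarrow> nat \<Rightarrow> real" and d :: "nat \<Rightarrow> nat" where
    "\<And>s. \<bar>s\<bar> \<le> B \<Longrightarrow> (\<lambda>n. \<Sum>i\<le>d n. a n i * s ^ i) \<longlonglongrightarrow> indicator {..t} s"
    "\<And>n s. \<bar>s\<bar> \<le> B \<Longrightarrow> \<bar>\<Sum>i\<le>d n. a n i * s ^ i\<bar> \<le> 2"
proof -
  \<comment> \<open>For positive \<open>n\<close> the ramp descends to the right of
    \<open>t\<close>, from 1 at \<open>t\<close> to 0 at \<open>t + 1/n\<close>, so that the limit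
    at \<open>t\<close> itself is 1, as the closed half-line requires.\<close>
  define ramp where "ramp n s = max 0 (min 1 (1 - real n * (s - t)))" for n s
  have "\<exists>a d. \<forall>s\<in>{-B..B}. \<bar>ramp n s - (\<Sum>i\<le>(d::nat). a i * s ^ i)\<bar> < inverse (Suc n)" for n
  proof -
    have "continuous_on {-B..B} (ramp n)"
      unfolding ramp_def by (intro continuous_intros)
    from Stone_Weierstrass_real_polynomial_function[OF compact_Icc this, of "inverse (Suc n)"]
    obtain g where "real_polynomial_function g" "\<And>s. s \<in> {-B..B} \<Longrightarrow> \<bar>ramp n s - g s\<bar> < inverse (Suc n)"
      by auto
    then show ?thesis unfolding real_polynomial_function_iff_sum by blast
  qed
  then obtain a d where ad: "\<And>n s. s \<in> {-B..B} \<Longrightarrow>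
      \<bar>ramp n s - (\<Sum>i\<le>(d n::nat). a n i * s ^ i)\<bar> < inverse (Suc n)"
    by metis
  show thesis
  proof
    fix s :: real assume s: "\<bar>s\<bar> \<le> B"
    have "(\<lambda>n. ramp n s) \<longlonglongrightarrow> indicator {..t} s"
    proof (cases "s \<le> t")
      case True
      then have "ramp n s = 1" for n
        by (simp add: ramp_def mult_nonneg_nonpos)
      then show ?thesis using True by simp
    next
      case False
      have "\<forall>\<^sub>F n in sequentially. ramp n s = 0"
        using eventually_ge_at_top[of "nat \<lceil>1 / (s - t)\<rceil>"]
      proof eventually_elim
        case (elim n)
        then have "1 / (s - t) \<le> real n" by linarith
        then have "1 \<le> real n * (s - t)" using False by (simp add: field_simps)
        then show ?case by (simp add: ramp_def)
      qed
      then show ?thesis using False by (simp add: tendsto_eventually)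
    qed
    moreover have "(\<lambda>n. ramp n s - (\<Sum>i\<le>d n. a n i * s ^ i)) \<longlonglongrightarrow> 0"
    proof (rule Lim_null_comparison[OF _ LIMSEQ_inverse_real_of_nat])
      show "\<forall>\<^sub>F n in sequentially.
          norm (ramp n s - (\<Sum>i\<le>d n. a n i * s ^ i)) \<le> inverse (real (Suc n))"
      proof (rule always_eventually, rule allI)
        show "norm (ramp n s - (\<Sum>i\<le>d n. a n i * s ^ i)) \<le> inverse (real (Suc n))" for n
          using ad[of s n] s by (auto simp: abs_le_iff intro: less_imp_le)
      qed
    qed
    ultimately have "(\<lambda>n. ramp n s - (ramp n s - (\<Sum>i\<le>d n. a n i * s ^ i)))
        \<longlonglongrightarrow> indicator {..t} s - 0"
      by (rule tendsto_diff)
    then show "(\<lambda>n. \<Sum>i\<le>d n. a n i * s ^ i) \<longlonglongrightarrow> indicator {..t} s" by simp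
    fix n
    \<comment> \<open>2 is the maximum 1 of the ramp plus the approximation error, which is at most
      1.\<close>
    have "0 \<le> ramp n s" "ramp n s \<le> 1" by (auto simp: ramp_def)
    moreover have "inverse (real (Suc n)) \<le> 1" by (simp add: field_simps)
    moreover have "\<bar>ramp n s - (\<Sum>i\<le>d n. a n i * s ^ i)\<bar> < inverse (Suc n)"
      using ad[of s n] s by (auto simp: abs_le_iff)
    ultimately show "\<bar>\<Sum>i\<le>d n. a n i * s ^ i\<bar> \<le> 2" by linarith
  qed
qed

section \<open>Distribution, mid-distribution and quantile function of one variable\<close>

locale real_rv = prob_space M for M :: "'a measure" +
  fixes X :: "'a \<Rightarrow> real"
  assumes rv [measurable]: "X \<in> borel_measurable M"
begin

abbreviation "\<mu> \<equiv> distr M borel X"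

sublocale law: cdf_distribution \<mu>
  unfolding cdf_distribution_def by (rule real_distribution_distr[OF rv])

lemma mid_cdf_eq: "mid_cdf M X x = measure \<mu> {..x} - measure \<mu> {x} / 2"
  by (simp add: mid_cdf_def cdf_def measure_distr vimage_def Int_def conj_commute)

lemma measure_atMost_less:
  "x < y \<Longrightarrow> measure \<mu> {..y} = measure \<mu> {..x} + measure \<mu> {x<..<y} + measure \<mu> {y}"
proof -
  assume "x < y"
  then have "{..y} = {..x} \<union> ({x<..<y} \<union> {y})" by auto
  moreover have "{..x} \<inter> ({x<..<y} \<union> {y}) = {}" using \<open>x < y\<close> by auto
  ultimately have "measure \<mu> {..y} = measure \<mu> {..x} + measure \<mu> ({x<..<y} \<union> {y})"
    using law.finite_measure_Union[of "{..x}" "{x<..<y} \<union> {y}"] by simp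
  also have "measure \<mu> ({x<..<y} \<union> {y}) = measure \<mu> {x<..<y} + measure \<mu> {y}"
    by (rule law.finite_measure_Union) auto
  finally show ?thesis by simp
qed

text \<open>All terms added to \<open>mid_cdf M X x\<close> are nonnegative: this gives
  monotonicity, and equal values at \<open>x < y\<close> force the interval from \<open>x\<close>
  (excluded) to \<open>y\<close> (included) to be null.\<close>

lemma mid_cdf_increment:
  assumes "x < y"
  shows "mid_cdf M X y = mid_cdf M X x + measure \<mu> {x} / 2 + measure \<mu> {x<..<y} + measure \<mu> {y} / 2"
  using measure_atMost_less[OF assms] by (simp add: mid_cdf_eq)

lemma mono_mid_cdf: "mono (mid_cdf M X)"
proof (rule monoI)
  show "mid_cdf M X x \<le> mid_cdf M X y" if "x \<le> y" for x y
    using that mid_cdf_increment[of x y] measure_nonneg[of \<mu> "{x}"]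
      measure_nonneg[of \<mu> "{x<..<y}"] measure_nonneg[of \<mu> "{y}"]
    by (cases "x = y") (linarith | auto)+
qed

lemma mid_cdf_measurable [measurable]: "mid_cdf M X \<in> borel_measurable borel"
  by (rule borel_measurable_mono[OF mono_mid_cdf])

lemma mid_cdf_bounds: "0 \<le> mid_cdf M X x" "mid_cdf M X x \<le> 1"
proof -
  have "measure \<mu> {x} \<le> measure \<mu> {..x}" by (intro law.finite_measure_mono) auto
  with measure_nonneg[of \<mu> "{x}"] show "0 \<le> mid_cdf M X x"
    unfolding mid_cdf_eq by linarith
  show "mid_cdf M X x \<le> 1"
    using measure_nonneg[of \<mu> "{x}"] law.prob_le_1[of "{..x}"] unfolding mid_cdf_eq by linarith
qed

text \<open>Right-continuity of the distribution function makes the infimum a minimum, whence a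
  Galois connection.\<close>

lemma quantile_le_iff: "0 < u \<Longrightarrow> u < 1 \<Longrightarrow> quantile M X u \<le> x \<longleftrightarrow> u \<le> cdf \<mu> x"
  unfolding quantile_def using law.pseudoinverse[of u x] by simp

lemma quantile_measurable [measurable]:
  "quantile M X \<in> borel_measurable (restrict_space borel {0<..<1})"
  unfolding quantile_def[abs_def] by (rule law.measurable_CI)

lemma distr_quantile: "distr (restrict_space lborel {0<..<1}) borel (quantile M X) = \<mu>"
  unfolding quantile_def[abs_def] by (rule law.distr_I_eq_M)

text \<open>A value \<open>x > a\<close> with the same mid-distribution as \<open>a\<close> also has the same distribution
  function as \<open>a\<close>, and no quantile takes such a value.\<close>

lemma AE_le_iff_mid_cdf_le: "AE x in \<mu>. x \<le> a \<longleftrightarrow> mid_cdf M X x \<le> mid_cdf M X a"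
proof -
  \<comment> \<open>Transported to the quantile variable \<open>u\<close>, the equivalence holds for
    every \<open>u\<close> in the open unit interval, so no exceptional set has to be
    described.\<close>
  have "AE u in restrict_space lborel {0<..<1}.
      quantile M X u \<le> a \<longleftrightarrow> mid_cdf M X (quantile M X u) \<le> mid_cdf M X a"
  proof (rule AE_I2)
    fix u :: real assume "u \<in> space (restrict_space lborel {0<..<1})"
    then have u: "0 < u" "u < 1" by (auto simp: space_restrict_space)
    let ?q = "quantile M X u"
    have False if "a < ?q" "mid_cdf M X ?q \<le> mid_cdf M X a"
    proof -
      have "measure \<mu> {a<..<?q} = 0" "measure \<mu> {?q} = 0"
        using mid_cdf_increment[OF that(1)] that(2) measure_nonneg[of \<mu> "{a}"]
          measure_nonneg[of \<mu> "{a<..<?q}"] measure_nonneg[of \<mu> "{?q}"] by linarith+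
      then have "cdf \<mu> ?q = cdf \<mu> a"
        using measure_atMost_less[OF that(1)] by (simp add: cdf_def)
      then show False
        using quantile_le_iff[OF u, of ?q] quantile_le_iff[OF u, of a] that(1) by auto
    qed
    then show "?q \<le> a \<longleftrightarrow> mid_cdf M X ?q \<le> mid_cdf M X a"
      using monoD[OF mono_mid_cdf] by force
  qed
  then have "AE x in distr (restrict_space lborel {0<..<1}) borel (quantile M X).
      x \<le> a \<longleftrightarrow> mid_cdf M X x \<le> mid_cdf M X a"
    by (subst AE_distr_iff) (auto cong: measurable_cong_sets simp: sets_restrict_space)
  then show ?thesis unfolding distr_quantile .
qed

section \<open>Gram-Schmidt scores: boundedness and orthonormality\<close>

definition score_bound :: real where
  "score_bound = 1 / \<bar>std_dev M (\<lambda>\<omega>. mid_cdf M X (X \<omega>))\<bar>"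

text \<open>If the standard deviation is 0, both sides are divisions by zero and hence 0, so the
  bound covers the degenerate case as well.\<close>

lemma first_score_bound: "\<bar>first_score M X x\<bar> \<le> score_bound"
proof -
  have "\<bar>mid_cdf M X x - 1 / 2\<bar> \<le> 1" using mid_cdf_bounds[of x] by linarith
  then show ?thesis
    by (simp add: first_score_def score_bound_def abs_divide divide_right_mono)
qed

lemma first_score_measurable [measurable]: "first_score M X \<in> borel_measurable borel"
  unfolding first_score_def[abs_def] by measurable

lemma score_residual_eq:
  "score_residual M X j = (\<lambda>x. first_score M X x ^ j
     - (\<Sum>i<j. score_inner M X (\<lambda>x. first_score M X x ^ j) (score M X i) * score M X i x))"
  unfolding score_residual_def score_def by (subst gs_residual.simps) (rule refl)

lemma score_eq:
  "score M X j x = score_residual M X j x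
     / sqrt (score_inner M X (score_residual M X j) (score_residual M X j))"
  by (simp add: score_def normalized_def)

text \<open>The two families depend on each other: residual \<open>j\<close> uses the scores below
  \<open>j\<close>, and score \<open>j\<close> uses residual \<open>j\<close>. One course-of-values
  induction therefore proves both claims, the second from the first.\<close>

lemma score_residual_measurable [measurable]: "score_residual M X j \<in> borel_measurable borel"
  and score_measurable [measurable]: "score M X j \<in> borel_measurable borel"
proof (induction j rule: less_induct)
  case (less j)
  { case 1
    have [measurable]: "score M X i \<in> borel_measurable borel" if "i \<in> {..<j}" for i
      using less that by auto
    show ?case unfolding score_residual_eq[of j] by measurable
    note this }
  note r [measurable] = this
  case 2
  show ?case unfolding score_eq[abs_def] by measurable
qed

text \<open>Scores are polynomials in the bounded function \<open>T_1\<close>. Boundedness, which is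
  more than square integrability, is what later makes the score products integrable against any
  joint density.\<close>

lemma score_residual_bounded: "\<exists>C. \<forall>x. \<bar>score_residual M X j x\<bar> \<le> C"
  and score_bounded: "\<exists>C. \<forall>x. \<bar>score M X j x\<bar> \<le> C"
proof (induction j rule: less_induct)
  case (less j)
  { case 1
    have "\<forall>i\<in>{..<j}. \<exists>C. \<forall>x. \<bar>score M X i x\<bar> \<le> C" using less by auto
    then obtain C where C: "\<And>i x. i < j \<Longrightarrow> \<bar>score M X i x\<bar> \<le> C i"
      by (metis lessThan_iff)
    let ?c = "\<lambda>i. score_inner M X (\<lambda>x. first_score M X x ^ j) (score M X i)"
    have "\<bar>score_residual M X j x\<bar> \<le> score_bound ^ j + (\<Sum>i<j. \<bar>?c i\<bar> * C i)" for x
    proof -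
      have "\<bar>score_residual M X j x\<bar> \<le> \<bar>first_score M X x ^ j\<bar> + \<bar>\<Sum>i<j. ?c i * score M X i x\<bar>"
        unfolding score_residual_eq[of j] by (rule abs_triangle_ineq4)
      also have "\<bar>first_score M X x ^ j\<bar> \<le> score_bound ^ j"
        unfolding power_abs by (intro power_mono first_score_bound) auto
      also have "\<bar>\<Sum>i<j. ?c i * score M X i x\<bar> \<le> (\<Sum>i<j. \<bar>?c i\<bar> * C i)"
        by (rule order_trans[OF sum_abs]) (auto intro!: sum_mono mult_left_mono C simp: abs_mult)
      finally show ?thesis by simp
    qed
    then show ?case by blast
    note this }
  note r = this
  case 2
  obtain C where C: "\<And>x. \<bar>score_residual M X j x\<bar> \<le> C" using r by blast
  have "\<bar>score M X j x\<bar> \<le> C / \<bar>sqrt (score_inner M X (score_residual M X j) (score_residual M X j))\<bar>" for x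
    unfolding score_eq abs_divide by (intro divide_right_mono C) auto
  then show ?case by blast
qed

lemma score_inner_law:
  assumes [measurable]: "a \<in> borel_measurable borel" "b \<in> borel_measurable borel"
  shows "score_inner M X a b = (\<integral>x. a x * b x \<partial>\<mu>)"
  by (simp add: score_inner_def integral_distr)

lemma bounded_mult_integrable:
  assumes "a \<in> borel_measurable borel" "b \<in> borel_measurable borel"
    "\<And>x. \<bar>a x\<bar> \<le> A" "\<And>x. \<bar>b x\<bar> \<le> B"
  shows "integrable \<mu> (\<lambda>x. a x * b x :: real)"
proof (rule law.integrable_const_bound[where B="A * B"])
  have "\<bar>a x * b x\<bar> \<le> A * B" for x
    unfolding abs_mult using assms(3,4) by (intro mult_mono) (auto intro: order_trans[OF abs_ge_zero])
  then show "AE x in \<mu>. norm (a x * b x) \<le> A * B" by simp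
  show "(\<lambda>x. a x * b x) \<in> borel_measurable \<mu>"
    using borel_measurable_times[OF assms(1,2)] by (simp cong: measurable_cong_sets)
qed

lemma score_mult_integrable: "integrable \<mu> (\<lambda>x. score M X i x * score M X j x)"
  using score_bounded[of i] score_bounded[of j] bounded_mult_integrable[of "score M X i" "score M X j"]
  by auto

lemma power_score_integrable: "integrable \<mu> (\<lambda>x. first_score M X x ^ i * score M X j x)"
proof -
  have "\<bar>first_score M X x ^ i\<bar> \<le> score_bound ^ i" for x
    unfolding power_abs by (intro power_mono first_score_bound) auto
  moreover obtain C where "\<And>x. \<bar>score M X j x\<bar> \<le> C" using score_bounded[of j] by blast
  ultimately show ?thesis by (intro bounded_mult_integrable[where A="score_bound ^ i"]) auto
qed

text \<open>A residual of norm 0 is divided by \<open>sqrt 0\<close>, and division by 0 gives 0: a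
  missing score is the zero function at every point, although its residual is known to vanish only
  almost everywhere.\<close>

lemma score_off_index: "j \<notin> score_index M X \<Longrightarrow> score M X j x = 0"
  by (simp add: score_index_def score_eq)

lemma score_residual_off_index:
  assumes "j \<notin> score_index M X"
  shows "AE x in \<mu>. score_residual M X j x = 0"
proof -
  obtain C where "\<And>x. \<bar>score_residual M X j x\<bar> \<le> C" using score_residual_bounded by blast
  then have "integrable \<mu> (\<lambda>x. score_residual M X j x * score_residual M X j x)"
    by (intro bounded_mult_integrable) auto
  moreover have "(\<integral>x. score_residual M X j x * score_residual M X j x \<partial>\<mu>) = 0"
    using assms by (simp add: score_index_def score_inner_law)
  ultimately show ?thesis
    by (subst (asm) integral_nonneg_eq_0_iff_AE) auto
qed

lemma score_norm:
  assumes "j \<in> score_index M X"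
  shows "(\<integral>x. score M X j x * score M X j x \<partial>\<mu>) = 1"
proof -
  let ?r = "score_residual M X j"
  let ?n = "score_inner M X ?r ?r"
  have "?n \<noteq> 0" using assms by (simp add: score_index_def)
  moreover have n: "?n = (\<integral>x. ?r x * ?r x \<partial>\<mu>)" by (simp add: score_inner_law)
  moreover have "0 \<le> (\<integral>x. ?r x * ?r x \<partial>\<mu>)" by (intro integral_nonneg_AE) simp
  ultimately have "0 < ?n" by linarith
  have "(\<integral>x. score M X j x * score M X j x \<partial>\<mu>) = (\<integral>x. (?r x * ?r x) / ?n \<partial>\<mu>)"
    unfolding score_eq times_divide_times_eq using \<open>0 < ?n\<close> by simp
  also have "\<dots> = 1" using n \<open>0 < ?n\<close> by simp
  finally show ?thesis .
qed

text \<open>Below \<open>j\<close> the scores are orthogonal by induction, so the subtracted sum has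
  exactly the inner product of the power with score \<open>k\<close>. An index \<open>k\<close>
  without a score is harmless, its score being the zero function.\<close>

lemma score_orthogonal_less: "k < j \<Longrightarrow> (\<integral>x. score M X j x * score M X k x \<partial>\<mu>) = 0"
proof (induction j arbitrary: k rule: less_induct)
  case (less j)
  let ?ip = "\<lambda>a b. \<integral>x. a x * b x \<partial>\<mu>"
  let ?T = "score M X" and ?p = "\<lambda>x. first_score M X x ^ j"
  show ?case
  proof (cases "k \<in> score_index M X")
    case False
    then show ?thesis by (simp add: score_off_index)
  next
    case True
    \<comment> \<open>The induction hypothesis serves both orders, \<open>i < k\<close> and
      \<open>k < i\<close>; \<open>score_norm\<close> serves the diagonal, where \<open>k\<close>
      must be in the index set.\<close>
    have ip: "?ip (?T i) (?T k) = (if i = k then 1 else 0)" if "i < j" for i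
      using less(1)[of i k] less(1)[of k i] that less(2) True
      by (cases i k rule: linorder_cases) (auto simp: score_norm mult.commute)
    have "?ip (score_residual M X j) (?T k)
        = (\<integral>x. ?p x * ?T k x - (\<Sum>i<j. score_inner M X ?p (?T i) * (?T i x * ?T k x)) \<partial>\<mu>)"
      unfolding score_residual_eq[of j] by (simp add: left_diff_distrib sum_distrib_right mult.assoc)
    also have "\<dots> = ?ip ?p (?T k) - (\<Sum>i<j. score_inner M X ?p (?T i) * ?ip (?T i) (?T k))"
      by (simp add: power_score_integrable score_mult_integrable)
    also have "(\<Sum>i<j. score_inner M X ?p (?T i) * ?ip (?T i) (?T k))
        = (\<Sum>i<j. if i = k then score_inner M X ?p (?T i) else 0)"
      by (intro sum.cong) (auto simp: ip)
    also have "\<dots> = ?ip ?p (?T k)"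
      using less(2) by (simp add: score_inner_law)
    finally have "?ip (score_residual M X j) (?T k) = 0" by simp
    then show ?thesis by (simp add: score_eq[of j])
  qed
qed

lemma score_orthonormal:
  assumes "i \<in> score_index M X" "j \<in> score_index M X"
  shows "(\<integral>x. score M X i x * score M X j x \<partial>\<mu>) = (if i = j then 1 else 0)"
  using score_orthogonal_less[of i j] score_orthogonal_less[of j i] score_norm[of i] assms
  by (cases i j rule: linorder_cases) (auto simp: mult.commute)

lemma score_0: "score M X 0 = (\<lambda>x. 1)" and zero_in_index: "0 \<in> score_index M X"
proof -
  have r: "score_residual M X 0 = (\<lambda>x. 1)" by (subst score_residual_eq) simp
  then have "score_inner M X (score_residual M X 0) (score_residual M X 0) = 1"
    by (simp add: score_inner_def prob_space)
  with r show "score M X 0 = (\<lambda>x. 1)" "0 \<in> score_index M X"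
    by (auto simp: score_eq score_index_def)
qed

section \<open>Indicators of half-lines as limits of score combinations\<close>

definition score_lincomb :: "(real \<Rightarrow> real) \<Rightarrow> bool" where
  "score_lincomb f \<longleftrightarrow> (\<exists>F b. finite F \<and> F \<subseteq> score_index M X \<and>
     (AE x in \<mu>. f x = (\<Sum>i\<in>F. b i * score M X i x)))"

text \<open>The Gram-Schmidt step solved for the power. A residual of norm 0 may be nonzero on a
  null set, so equality can be claimed only almost everywhere; \<open>score_lincomb\<close> is
  phrased accordingly.\<close>

lemma power_score_lincomb:
  "\<exists>b. AE x in \<mu>. first_score M X x ^ j = (\<Sum>i\<in>score_index M X \<inter> {..j}. b i * score M X i x)"
proof -
  let ?n = "sqrt (score_inner M X (score_residual M X j) (score_residual M X j))"
  \<comment> \<open>The coefficient of score \<open>j\<close> is the norm of its residual, which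
    undoes the normalization; off the index set it is 0.\<close>
  define b where "b i = (if i = j then ?n
      else score_inner M X (\<lambda>x. first_score M X x ^ j) (score M X i))" for i
  have "AE x in \<mu>. score_residual M X j x = ?n * score M X j x"
  proof (cases "j \<in> score_index M X")
    case True
    then show ?thesis by (simp add: score_eq[of j] score_index_def)
  next
    case False
    then show ?thesis using score_residual_off_index[OF False] by (simp add: score_off_index)
  qed
  then have "AE x in \<mu>. first_score M X x ^ j = (\<Sum>i\<in>score_index M X \<inter> {..j}. b i * score M X i x)"
  proof eventually_elim
    case (elim x)
    have "first_score M X x ^ j
        = (\<Sum>i<j. b i * score M X i x) + score_residual M X j x"
      using fun_cong[OF score_residual_eq, of j x] by (simp add: b_def)
    also have "score_residual M X j x = b j * score M X j x"
      using elim by (simp add: b_def)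
    also have "(\<Sum>i<j. b i * score M X i x) + \<dots> = (\<Sum>i\<le>j. b i * score M X i x)"
      by (simp add: lessThan_Suc_atMost[symmetric])
    also have "\<dots> = (\<Sum>i\<in>score_index M X \<inter> {..j}. b i * score M X i x)"
    proof (rule sum.mono_neutral_right)
      show "\<forall>i\<in>{..j} - score_index M X \<inter> {..j}. b i * score M X i x = 0"
      proof
        fix i assume "i \<in> {..j} - score_index M X \<inter> {..j}"
        then have "i \<notin> score_index M X" by auto
        then show "b i * score M X i x = 0" by (simp add: score_off_index)
      qed
    qed auto
    finally show ?case .
  qed
  then show ?thesis by blast
qed

lemma poly_score_lincomb: "score_lincomb (\<lambda>x. \<Sum>j\<le>d. a j * first_score M X x ^ j)"
proof -
  obtain b where b: "\<And>j. AE x in \<mu>. first_score M X x ^ j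
      = (\<Sum>i\<in>score_index M X \<inter> {..j}. b j i * score M X i x)"
    using power_score_lincomb by metis
  let ?F = "score_index M X \<inter> {..d}"
  have "AE x in \<mu>. \<forall>j. first_score M X x ^ j
      = (\<Sum>i\<in>score_index M X \<inter> {..j}. b j i * score M X i x)"
    using b by (simp add: AE_all_countable)
  then have "AE x in \<mu>. (\<Sum>j\<le>d. a j * first_score M X x ^ j)
      = (\<Sum>i\<in>?F. (\<Sum>j\<le>d. if i \<le> j then a j * b j i else 0) * score M X i x)"
  proof eventually_elim
    case (elim x)
    have "(\<Sum>j\<le>d. a j * first_score M X x ^ j)
        = (\<Sum>j\<le>d. \<Sum>i\<in>?F. (if i \<le> j then a j * b j i else 0) * score M X i x)"
    proof (rule sum.cong[OF refl])
      fix j assume "j \<in> {..d}"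
      then have "(\<Sum>i\<in>?F. (if i \<le> j then a j * b j i else 0) * score M X i x)
          = (\<Sum>i\<in>score_index M X \<inter> {..j}. a j * b j i * score M X i x)"
        by (intro sum.mono_neutral_cong_right) auto
      then show "a j * first_score M X x ^ j
          = (\<Sum>i\<in>?F. (if i \<le> j then a j * b j i else 0) * score M X i x)"
        using elim by (simp add: sum_distrib_left mult.assoc)
    qed
    then show ?case by (simp add: sum.swap[of _ "{..d}"] sum_distrib_right)
  qed
  then show ?thesis unfolding score_lincomb_def by (intro exI[of _ ?F] exI) auto
qed

text \<open>Handles the degenerate case, in which \<open>first_score\<close> is identically 0 by
  division by zero and carries no information about \<open>X\<close>.\<close>

lemma constant_mid_cdf:
  assumes "std_dev M (\<lambda>\<omega>. mid_cdf M X (X \<omega>)) = 0"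
  shows "\<exists>m. AE x in \<mu>. mid_cdf M X x = m"
proof -
  let ?Z = "\<lambda>\<omega>. mid_cdf M X (X \<omega>)"
  have "AE \<omega> in M. (?Z \<omega> - expectation ?Z)\<^sup>2 = 0"
  proof (subst integral_nonneg_eq_0_iff_AE[symmetric])
    have "\<bar>expectation ?Z\<bar> \<le> 1"
    proof -
      have "\<bar>expectation ?Z\<bar> \<le> expectation (\<lambda>\<omega>. \<bar>?Z \<omega>\<bar>)" by (rule integral_abs_bound)
      also have "\<dots> \<le> expectation (\<lambda>\<omega>. 1)"
        by (intro integral_mono' ) (use mid_cdf_bounds in auto)
      finally show ?thesis by (simp add: prob_space)
    qed
    then have "\<bar>?Z \<omega> - expectation ?Z\<bar> \<le> 2" for \<omega>
      using mid_cdf_bounds[of "X \<omega>"] by linarith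
    then have "(?Z \<omega> - expectation ?Z)\<^sup>2 \<le> 2\<^sup>2" for \<omega>
      by (subst abs_le_square_iff[symmetric]) simp
    then show "integrable M (\<lambda>\<omega>. (?Z \<omega> - expectation ?Z)\<^sup>2)"
      by (intro integrable_const_bound[where B="2\<^sup>2"]) auto
    show "expectation (\<lambda>\<omega>. (?Z \<omega> - expectation ?Z)\<^sup>2) = 0"
      using assms by (simp add: std_dev_def)
  qed simp
  then show ?thesis by (intro exI[of _ "expectation ?Z"]) (simp add: AE_distr_iff)
qed

text \<open>Explicit bounded sequences are produced, not mere membership in the closure, because in
  the plane such a sequence for \<open>X\<close> is multiplied by one for \<open>Y\<close>. In the
  degenerate case the event is almost surely decided, and a multiple of the constant score is
  enough.\<close>

lemma indicator_atMost_approx: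
  obtains f :: "nat \<Rightarrow> real \<Rightarrow> real" where
    "\<And>n. f n \<in> borel_measurable borel" "\<And>n. score_lincomb (f n)" "\<And>n x. \<bar>f n x\<bar> \<le> 2"
    "AE x in \<mu>. (\<lambda>n. f n x) \<longlonglongrightarrow> indicator {..a} x"
proof (cases "std_dev M (\<lambda>\<omega>. mid_cdf M X (X \<omega>)) = 0")
  case True
  then obtain m where m: "AE x in \<mu>. mid_cdf M X x = m"
    using constant_mid_cdf by blast
  define f :: "nat \<Rightarrow> real \<Rightarrow> real" where "f n x = (if m \<le> mid_cdf M X a then 1 else 0)" for n x
  show thesis
  proof (rule that[of f])
    show "score_lincomb (f n)" for n
      unfolding score_lincomb_def f_def using zero_in_index
      by (intro exI[of _ "{0}"] exI[of _ "\<lambda>i. if m \<le> mid_cdf M X a then 1 else 0"]) (auto simp: score_0)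
    show "AE x in \<mu>. (\<lambda>n. f n x) \<longlonglongrightarrow> indicator {..a} x"
      using m AE_le_iff_mid_cdf_le[of a] by eventually_elim (auto simp: f_def)
  qed (auto simp: f_def[abs_def])
next
  case False
  then have \<sigma>: "0 < std_dev M (\<lambda>\<omega>. mid_cdf M X (X \<omega>))"
    by (simp add: std_dev_def less_le)
  \<comment> \<open>Division by a positive standard deviation preserves order, so thresholds for the
    mid-distribution turn into thresholds for \<open>T_1\<close>.\<close>
  then have iff: "first_score M X x \<le> first_score M X a \<longleftrightarrow> mid_cdf M X x \<le> mid_cdf M X a" for x
    by (simp add: first_score_def divide_le_cancel)
  obtain c :: "nat \<Rightarrow> nat \<Rightarrow> real" and d where c:
    "\<And>s. \<bar>s\<bar> \<le> score_bound \<Longrightarrow>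
       (\<lambda>n. \<Sum>i\<le>d n. c n i * s ^ i) \<longlonglongrightarrow> indicator {..first_score M X a} s"
    "\<And>n s. \<bar>s\<bar> \<le> score_bound \<Longrightarrow> \<bar>\<Sum>i\<le>d n. c n i * s ^ i\<bar> \<le> 2"
    by (rule polynomials_approach_step) blast
  show thesis
  proof (rule that[of "\<lambda>n x. \<Sum>i\<le>d n. c n i * first_score M X x ^ i"])
    show "AE x in \<mu>. (\<lambda>n. \<Sum>i\<le>d n. c n i * first_score M X x ^ i) \<longlonglongrightarrow> indicator {..a} x"
      using AE_le_iff_mid_cdf_le[of a]
    proof eventually_elim
      case (elim x)
      then have "indicator {..first_score M X a} (first_score M X x) = (indicator {..a} x :: real)"
        by (simp add: iff indicator_def)
      then show ?case using c(1)[OF first_score_bound[of x]] by simp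
    qed
  qed (use c(2) first_score_bound poly_score_lincomb in auto)
qed

end

subsection \<open>The copula density as a joint density\<close>

text \<open>Reduces an integral to the atoms of a discrete variable. It is applied under
  \<open>M\<close> and, with the identity as \<open>Z\<close>, under the marginal laws.\<close>

lemma nn_integral_countable_partition:
  fixes Z :: "'a \<Rightarrow> real"
  assumes D: "countable D" "AE x in M. Z x \<in> D"
    and [measurable]: "Z \<in> borel_measurable M" "f \<in> borel_measurable M"
  shows "(\<integral>\<^sup>+x. f x \<partial>M) = (\<integral>\<^sup>+d. (\<integral>\<^sup>+x. f x * indicator {d} (Z x) \<partial>M) \<partial>count_space D)"
proof -
  have "(\<integral>\<^sup>+x. f x \<partial>M) = (\<integral>\<^sup>+x. (\<integral>\<^sup>+d. f x * indicator {d} (Z x) \<partial>count_space D) \<partial>M)"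
  proof (rule nn_integral_cong_AE)
    show "AE x in M. f x = (\<integral>\<^sup>+d. f x * indicator {d} (Z x) \<partial>count_space D)"
      using D(2)
    proof eventually_elim
      case (elim x)
      have "(\<integral>\<^sup>+d. f x * indicator {d} (Z x) \<partial>count_space D)
          = (\<integral>\<^sup>+d. f x * indicator {Z x} d \<partial>count_space D)"
        by (intro nn_integral_cong) (auto simp: indicator_def)
      also have "\<dots> = f x * emeasure (count_space D) {Z x}"
        using elim by (intro nn_integral_cmult_indicator) simp
      finally show ?case using elim by simp
    qed
  qed
  also have "\<dots> = (\<integral>\<^sup>+d. (\<integral>\<^sup>+x. f x * indicator {d} (Z x) \<partial>M) \<partial>count_space D)"
    by (rule nn_integral_count_space_nn_integral[OF D(1)]) measurable
  finally show ?thesis .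
qed

lemma pair_borel_measure_eqI:
  fixes P Q :: "(real \<times> real) measure"
  assumes P: "sets P = sets (borel \<Otimes>\<^sub>M borel)" and Q: "sets Q = sets (borel \<Otimes>\<^sub>M borel)"
    and fin: "emeasure P UNIV \<noteq> \<infinity>"
    and eq: "\<And>A B. A \<in> sets borel \<Longrightarrow> B \<in> sets borel \<Longrightarrow> emeasure P (A \<times> B) = emeasure Q (A \<times> B)"
  shows "P = Q"
proof (rule measure_eqI_generator_eq[OF Int_stable_pair_measure_generator])
  let ?E = "{a \<times> b | a b. a \<in> sets (borel :: real measure) \<and> b \<in> sets (borel :: real measure)}"
  show "?E \<subseteq> Pow (UNIV :: (real \<times> real) set)" by simp
  show "sets P = sigma_sets UNIV ?E" "sets Q = sigma_sets UNIV ?E"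
    unfolding P Q sets_pair_measure by simp_all
  show "range (\<lambda>i::nat. UNIV \<times> UNIV :: (real \<times> real) set) \<subseteq> ?E"
    by (rule image_subsetI, rule CollectI, intro exI[of _ UNIV]) simp
  show "(\<Union>i::nat. UNIV \<times> UNIV) = (UNIV :: (real \<times> real) set)" by simp
  show "emeasure P (UNIV \<times> UNIV) \<noteq> \<infinity>" for i :: nat using fin by simp
qed (use eq in auto)

text \<open>Nonnegativity is a clause of its own, since \<open>ennreal\<close> hides negative
  values. It is asked only almost everywhere because a version of a conditional probability may be
  negative on a null set.\<close>

definition joint_density :: "'a measure \<Rightarrow> ('a \<Rightarrow> real) \<Rightarrow> ('a \<Rightarrow> real) \<Rightarrow> (real \<times> real \<Rightarrow> real) \<Rightarrow> bool" where
  "joint_density M X Y c \<longleftrightarrow> c \<in> borel_measurable (borel \<Otimes>\<^sub>M borel) \<and>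
     (AE z in distr M borel X \<Otimes>\<^sub>M distr M borel Y. 0 \<le> c z) \<and>
     distr M (borel \<Otimes>\<^sub>M borel) (\<lambda>\<omega>. (X \<omega>, Y \<omega>))
       = density (distr M borel X \<Otimes>\<^sub>M distr M borel Y) (\<lambda>z. ennreal (c z))"

section \<open>Joint density for the combinations of discrete and continuous variables\<close>

locale two_rvs = prob_space M for M :: "'a measure" +
  fixes X Y :: "'a \<Rightarrow> real"
  assumes X_rv [measurable]: "X \<in> borel_measurable M" and Y_rv [measurable]: "Y \<in> borel_measurable M"
begin

abbreviation "\<mu> \<equiv> distr M borel X"
abbreviation "\<nu> \<equiv> distr M borel Y"

sublocale mu: prob_space \<mu> by (rule prob_space_distr) measurable
sublocale nu: prob_space \<nu> by (rule prob_space_distr) measurable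
sublocale P: pair_prob_space \<mu> \<nu> ..

lemma sets_P [measurable_cong]: "sets (\<mu> \<Otimes>\<^sub>M \<nu>) = sets (borel \<Otimes>\<^sub>M borel)"
  by (intro sets_pair_measure_cong) auto

text \<open>Common core of the cases with discrete \<open>Y\<close>: slicing along the values of
  \<open>Y\<close>, the joint law is determined by its restrictions to the lines
  \<open>Y = y\<close>, which \<open>joint\<close> describes.\<close>

lemma discrete_joint_density:
  assumes D: "countable D" "AE \<omega> in M. Y \<omega> \<in> D"
    and [measurable]: "\<And>y. g y \<in> borel_measurable borel"
    and pos: "\<And>y. AE x in \<mu>. 0 \<le> g y x"
    and joint: "\<And>y A. A \<in> sets borel \<Longrightarrow>
      emeasure M {\<omega>\<in>space M. X \<omega> \<in> A \<and> Y \<omega> = y} = (\<integral>\<^sup>+x. ennreal (g y x) * indicator A x \<partial>\<mu>)"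
  shows "joint_density M X Y (\<lambda>(x, y). g y x / \<P>(\<omega> in M. Y \<omega> = y))"
proof -
  let ?p = "\<lambda>y. \<P>(\<omega> in M. Y \<omega> = y)"
  let ?c = "\<lambda>(x, y). g y x / ?p y"
  have p_nu: "?p y = measure \<nu> {y}" for y
    by (simp add: measure_distr vimage_def Int_def conj_commute)
  have C: "countable {y. ?p y \<noteq> 0}"
    unfolding p_nu by (rule nu.countable_support)
  have c [measurable]: "?c \<in> borel_measurable (borel \<Otimes>\<^sub>M borel)"
  proof -
    \<comment> \<open>Each \<open>g y\<close> is measurable, but nothing is known in the direction
      of \<open>y\<close>. Off the countably many atoms of \<open>Y\<close> the denominator is 0 and
      so is the quotient; \<open>None\<close> stands for these \<open>y\<close>, and a countable
      case distinction remains.\<close>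
    let ?I = "insert None (Some ` {y. ?p y \<noteq> 0})"
    let ?h = "\<lambda>z::real \<times> real. if ?p (snd z) \<noteq> 0 then Some (snd z) else None"
    have "(\<lambda>z. (\<lambda>i z. case i of None \<Rightarrow> 0 | Some y \<Rightarrow> g y (fst z) / ?p y) (?h z) z)
        \<in> borel_measurable (borel \<Otimes>\<^sub>M borel)"
    proof (rule measurable_compose_countable'[where I="?I"])
      show "(\<lambda>z. case i of None \<Rightarrow> 0 | Some y \<Rightarrow> g y (fst z) / ?p y)
          \<in> borel_measurable (borel \<Otimes>\<^sub>M borel)" for i
        by (cases i) auto
      show "?h \<in> borel \<Otimes>\<^sub>M borel \<rightarrow>\<^sub>M count_space ?I"
      proof (subst measurable_count_space_eq_countable)
        show "countable ?I" using C by simp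
        have "?h -` {i} \<inter> space (borel \<Otimes>\<^sub>M borel) \<in> sets (borel \<Otimes>\<^sub>M borel)" if "i \<in> ?I" for i
        proof (cases i)
          case (Some y)
          then have "?h -` {i} \<inter> space (borel \<Otimes>\<^sub>M borel) = UNIV \<times> {y}"
            using that by (auto simp: space_pair_measure split: if_splits)
          then show ?thesis
            by (simp only:) (intro pair_measureI, simp_all)
        next
          case None
          then have "?h -` {i} \<inter> space (borel \<Otimes>\<^sub>M borel) = UNIV \<times> (UNIV - {y. ?p y \<noteq> 0})"
            by (auto simp: space_pair_measure split: if_splits)
          moreover have "UNIV - {y. ?p y \<noteq> 0} \<in> sets borel"
            by (intro sets.Diff sets.countable[OF _ C]) simp_all
          ultimately show ?thesis
            by (simp only:) (intro pair_measureI, simp_all)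
        qed
        then show "?h \<in> space (borel \<Otimes>\<^sub>M borel) \<rightarrow> ?I \<and>
            (\<forall>i\<in>?I. ?h -` {i} \<inter> space (borel \<Otimes>\<^sub>M borel) \<in> sets (borel \<Otimes>\<^sub>M borel))"
          by auto
      qed
      show "countable ?I" using C by simp
    qed
    also have "(\<lambda>z. (\<lambda>i z. case i of None \<Rightarrow> 0 | Some y \<Rightarrow> g y (fst z) / ?p y) (?h z) z) = ?c"
      by (auto simp: fun_eq_iff)
    finally show ?thesis .
  qed
  have "AE z in \<mu> \<Otimes>\<^sub>M \<nu>. 0 \<le> ?c z"
  proof (rule P.AE_pair_measure)
    show "{z \<in> space (\<mu> \<Otimes>\<^sub>M \<nu>). 0 \<le> ?c z} \<in> sets (\<mu> \<Otimes>\<^sub>M \<nu>)" by measurable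
    \<comment> \<open>Countably many atoms leave one common null set of \<open>x\<close>; at other
      \<open>y\<close> the quotient is 0.\<close>
    have "AE x in \<mu>. \<forall>y\<in>{y. ?p y \<noteq> 0}. 0 \<le> g y x"
      using pos by (intro AE_ball_countable[OF C, THEN iffD2]) auto
    then show "AE x in \<mu>. AE y in \<nu>. 0 \<le> ?c (x, y)"
    proof eventually_elim
      case (elim x)
      show ?case
      proof (rule AE_I2)
        show "0 \<le> ?c (x, y)" for y using elim by (cases "?p y = 0") auto
      qed
    qed
  qed
  moreover have "distr M (borel \<Otimes>\<^sub>M borel) (\<lambda>\<omega>. (X \<omega>, Y \<omega>))
       = density (\<mu> \<Otimes>\<^sub>M \<nu>) (\<lambda>z. ennreal (?c z))"
  proof (rule pair_borel_measure_eqI)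
    interpret D: prob_space "distr M (borel \<Otimes>\<^sub>M borel) (\<lambda>\<omega>. (X \<omega>, Y \<omega>))"
      by (rule prob_space_distr) measurable
    show "emeasure (distr M (borel \<Otimes>\<^sub>M borel) (\<lambda>\<omega>. (X \<omega>, Y \<omega>))) UNIV \<noteq> \<infinity>"
      by simp
    show "sets (density (\<mu> \<Otimes>\<^sub>M \<nu>) (\<lambda>z. ennreal (?c z))) = sets (borel \<Otimes>\<^sub>M borel)"
      by (simp add: sets_P)
    fix A B :: "real set" assume [measurable]: "A \<in> sets borel" "B \<in> sets borel"
    have Dnu: "AE y in \<nu>. y \<in> D"
      using D sets.countable[of D borel] by (subst AE_distr_iff) auto
    have "emeasure (distr M (borel \<Otimes>\<^sub>M borel) (\<lambda>\<omega>. (X \<omega>, Y \<omega>))) (A \<times> B)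
        = emeasure M {\<omega>\<in>space M. X \<omega> \<in> A \<and> Y \<omega> \<in> B}"
      by (subst emeasure_distr) (auto intro!: arg_cong[where f="emeasure M"])
    also have "\<dots> = (\<integral>\<^sup>+\<omega>. indicator {\<omega>\<in>space M. X \<omega> \<in> A \<and> Y \<omega> \<in> B} \<omega> \<partial>M)"
      by simp
    also have "\<dots> = (\<integral>\<^sup>+d. (\<integral>\<^sup>+\<omega>. indicator {\<omega>\<in>space M. X \<omega> \<in> A \<and> Y \<omega> \<in> B} \<omega>
        * indicator {d} (Y \<omega>) \<partial>M) \<partial>count_space D)"
      by (rule nn_integral_countable_partition[OF D]) measurable
    also have "\<dots> = (\<integral>\<^sup>+d. indicator B d * (\<integral>\<^sup>+x. ennreal (g d x) * indicator A x \<partial>\<mu>) \<partial>count_space D)"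
    proof (rule nn_integral_cong)
      fix d
      have "(\<integral>\<^sup>+\<omega>. indicator {\<omega>\<in>space M. X \<omega> \<in> A \<and> Y \<omega> \<in> B} \<omega> * indicator {d} (Y \<omega>) \<partial>M)
          = (\<integral>\<^sup>+\<omega>. indicator B d * indicator {\<omega>\<in>space M. X \<omega> \<in> A \<and> Y \<omega> = d} \<omega> \<partial>M)"
        by (intro nn_integral_cong) (auto simp: indicator_def)
      also have "\<dots> = indicator B d * emeasure M {\<omega>\<in>space M. X \<omega> \<in> A \<and> Y \<omega> = d}"
        by (rule nn_integral_cmult_indicator) measurable
      finally show "(\<integral>\<^sup>+\<omega>. indicator {\<omega>\<in>space M. X \<omega> \<in> A \<and> Y \<omega> \<in> B} \<omega> * indicator {d} (Y \<omega>) \<partial>M)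
          = indicator B d * (\<integral>\<^sup>+x. ennreal (g d x) * indicator A x \<partial>\<mu>)"
        by (simp add: joint)
    qed
    also have "\<dots> = (\<integral>\<^sup>+d. (\<integral>\<^sup>+y. (\<integral>\<^sup>+x. ennreal (?c (x, y)) * indicator (A \<times> B) (x, y) \<partial>\<mu>)
        * indicator {d} y \<partial>\<nu>) \<partial>count_space D)"
    proof (rule nn_integral_cong)
      fix d
      have "(\<integral>\<^sup>+y. (\<integral>\<^sup>+x. ennreal (?c (x, y)) * indicator (A \<times> B) (x, y) \<partial>\<mu>) * indicator {d} y \<partial>\<nu>)
         = (\<integral>\<^sup>+y. (\<integral>\<^sup>+x. ennreal (?c (x, d)) * indicator (A \<times> B) (x, d) \<partial>\<mu>) * indicator {d} y \<partial>\<nu>)"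
        by (intro nn_integral_cong) (auto simp: indicator_def)
      also have "\<dots> = (\<integral>\<^sup>+x. ennreal (?c (x, d)) * indicator (A \<times> B) (x, d) \<partial>\<mu>) * emeasure \<nu> {d}"
        by (rule nn_integral_cmult_indicator) simp
      also have "\<dots> = (\<integral>\<^sup>+x. ennreal (?p d) * (ennreal (?c (x, d)) * indicator (A \<times> B) (x, d)) \<partial>\<mu>)"
        by (simp add: nn_integral_cmult nu.emeasure_eq_measure p_nu mult.commute)
      also have "\<dots> = (\<integral>\<^sup>+x. indicator B d * (ennreal (g d x) * indicator A x) \<partial>\<mu>)"
      \<comment> \<open>Cancelling \<open>?p d\<close> against the denominator fails for
        \<open>?p d = 0\<close>. Then the left side is 0, and the right side is bounded by the
        probability of the null event \<open>Y = d\<close>.\<close>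
      proof (cases "?p d = 0")
        case True
        have "emeasure M {\<omega>\<in>space M. X \<omega> \<in> A \<and> Y \<omega> = d} \<le> emeasure M {\<omega>\<in>space M. Y \<omega> = d}"
          by (intro emeasure_mono) auto
        also have "\<dots> = 0" using True by (simp add: emeasure_eq_measure)
        finally show ?thesis using True joint[of A d] by (simp add: nn_integral_cmult)
      next
        case False
        then have "0 < ?p d" by (simp add: less_le)
        then have eq: "ennreal (?p d) * ennreal (g d x / ?p d) = ennreal (g d x)" for x
          by (simp add: ennreal_mult'[symmetric])
        show ?thesis
        proof (rule nn_integral_cong)
          fix x
          have "ennreal (?p d) * (ennreal (?c (x, d)) * indicator (A \<times> B) (x, d))
              = (ennreal (?p d) * ennreal (g d x / ?p d)) * (indicator A x * indicator B d)"
            by (simp add: indicator_times mult.assoc)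
          then show "ennreal (?p d) * (ennreal (?c (x, d)) * indicator (A \<times> B) (x, d))
              = indicator B d * (ennreal (g d x) * indicator A x)"
            unfolding eq by (simp only: mult_ac)
        qed
      qed
      finally show "indicator B d * (\<integral>\<^sup>+x. ennreal (g d x) * indicator A x \<partial>\<mu>)
         = (\<integral>\<^sup>+y. (\<integral>\<^sup>+x. ennreal (?c (x, y)) * indicator (A \<times> B) (x, y) \<partial>\<mu>) * indicator {d} y \<partial>\<nu>)"
        by (simp add: nn_integral_cmult)
    qed
    also have "\<dots> = (\<integral>\<^sup>+y. (\<integral>\<^sup>+x. ennreal (?c (x, y)) * indicator (A \<times> B) (x, y) \<partial>\<mu>) \<partial>\<nu>)"
      by (rule nn_integral_countable_partition[OF D(1) Dnu, symmetric]) measurable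
    also have "\<dots> = (\<integral>\<^sup>+z. ennreal (?c z) * indicator (A \<times> B) z \<partial>(\<mu> \<Otimes>\<^sub>M \<nu>))"
      by (rule P.nn_integral_snd) measurable
    also have "\<dots> = emeasure (density (\<mu> \<Otimes>\<^sub>M \<nu>) (\<lambda>z. ennreal (?c z))) (A \<times> B)"
      by (subst emeasure_density) auto
    finally show "emeasure (distr M (borel \<Otimes>\<^sub>M borel) (\<lambda>\<omega>. (X \<omega>, Y \<omega>))) (A \<times> B)
        = emeasure (density (\<mu> \<Otimes>\<^sub>M \<nu>) (\<lambda>z. ennreal (?c z))) (A \<times> B)" .
  qed simp
  ultimately show ?thesis using c unfolding joint_density_def by blast
qed

lemma discrete_discrete_joint_density:
  assumes "discrete_rv M X" "discrete_rv M Y"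
  shows "joint_density M X Y
    (\<lambda>(x, y). \<P>(\<omega> in M. Y \<omega> = y \<bar> X \<omega> = x) / \<P>(\<omega> in M. Y \<omega> = y))"
proof -
  obtain D where D: "countable D" "AE \<omega> in M. Y \<omega> \<in> D"
    using assms by (auto simp: discrete_rv_def)
  obtain C where C: "countable C" "AE \<omega> in M. X \<omega> \<in> C"
    using assms by (auto simp: discrete_rv_def)
  have Cm: "AE x in \<mu>. x \<in> C"
    using C sets.countable[of C borel] by (subst AE_distr_iff) auto
  let ?g = "\<lambda>y x. \<P>(\<omega> in M. Y \<omega> = y \<bar> X \<omega> = x)"
  have p_mu: "\<P>(\<omega> in M. X \<omega> = x) = measure \<mu> {x}" for x
    by (simp add: measure_distr vimage_def Int_def conj_commute)
  have S: "countable {x. measure \<mu> {x} \<noteq> 0}"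
    by (rule mu.countable_support)
  \<comment> \<open>A conditional probability given a null event is 0, a division by zero; hence
    \<open>?g y\<close> can differ from 0 only on the countable set of atoms of
    \<open>X\<close>.\<close>
  have g [measurable]: "?g y \<in> borel_measurable borel" for y
  proof (rule measurable_discrete_difference[where f="\<lambda>x. 0"])
    show "countable {x. measure \<mu> {x} \<noteq> 0}" by (rule S)
    show "0 = ?g y x" if "x \<notin> {x. measure \<mu> {x} \<noteq> 0}" for x
      using that by (simp add: cond_prob_def p_mu)
  qed auto
  have "joint_density M X Y (\<lambda>(x, y). ?g y x / \<P>(\<omega> in M. Y \<omega> = y))"
  proof (rule discrete_joint_density[OF D g])
    show "AE x in \<mu>. 0 \<le> ?g y x" for y
      by (simp add: cond_prob_def)
    fix y :: real and A :: "real set" assume [measurable]: "A \<in> sets borel"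
    have "emeasure M {\<omega>\<in>space M. X \<omega> \<in> A \<and> Y \<omega> = y}
        = (\<integral>\<^sup>+\<omega>. indicator {\<omega>\<in>space M. X \<omega> \<in> A \<and> Y \<omega> = y} \<omega> \<partial>M)"
      by simp
    also have "\<dots> = (\<integral>\<^sup>+x. (\<integral>\<^sup>+\<omega>. indicator {\<omega>\<in>space M. X \<omega> \<in> A \<and> Y \<omega> = y} \<omega>
        * indicator {x} (X \<omega>) \<partial>M) \<partial>count_space C)"
      by (rule nn_integral_countable_partition[OF C]) measurable
    also have "\<dots> = (\<integral>\<^sup>+x. (\<integral>\<^sup>+t. ennreal (?g y t) * indicator A t * indicator {x} t \<partial>\<mu>) \<partial>count_space C)"
    proof (rule nn_integral_cong)
      fix x
      have "(\<integral>\<^sup>+\<omega>. indicator {\<omega>\<in>space M. X \<omega> \<in> A \<and> Y \<omega> = y} \<omega> * indicator {x} (X \<omega>) \<partial>M)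
          = (\<integral>\<^sup>+\<omega>. indicator A x * indicator {\<omega>\<in>space M. Y \<omega> = y \<and> X \<omega> = x} \<omega> \<partial>M)"
        by (intro nn_integral_cong) (auto simp: indicator_def)
      also have "\<dots> = indicator A x * ennreal (\<P>(\<omega> in M. Y \<omega> = y \<and> X \<omega> = x))"
        by (subst nn_integral_cmult_indicator) (auto simp: emeasure_eq_measure)
      also have "\<P>(\<omega> in M. Y \<omega> = y \<and> X \<omega> = x) = ?g y x * measure \<mu> {x}"
      proof (cases "measure \<mu> {x} = 0")
        case True
        have "\<P>(\<omega> in M. Y \<omega> = y \<and> X \<omega> = x) \<le> \<P>(\<omega> in M. X \<omega> = x)"
          by (intro finite_measure_mono) auto
        then show ?thesis using True p_mu[of x] measure_nonneg[of M "{\<omega>\<in>space M. Y \<omega> = y \<and> X \<omega> = x}"]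
          by (simp add: order.antisym)
      qed (simp add: cond_prob_def p_mu)
      also have "indicator A x * ennreal (?g y x * measure \<mu> {x})
          = ennreal (?g y x) * indicator A x * emeasure \<mu> {x}"
      proof -
        have "0 \<le> ?g y x" by (simp add: cond_prob_def)
        then show ?thesis by (simp add: ennreal_mult mu.emeasure_eq_measure mult_ac)
      qed
      also have "\<dots> = (\<integral>\<^sup>+t. ennreal (?g y x) * indicator A x * indicator {x} t \<partial>\<mu>)"
        by (subst nn_integral_cmult_indicator) auto
      also have "\<dots> = (\<integral>\<^sup>+t. ennreal (?g y t) * indicator A t * indicator {x} t \<partial>\<mu>)"
        by (intro nn_integral_cong) (auto simp: indicator_def)
      finally show "(\<integral>\<^sup>+\<omega>. indicator {\<omega>\<in>space M. X \<omega> \<in> A \<and> Y \<omega> = y} \<omega> * indicator {x} (X \<omega>) \<partial>M)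
          = (\<integral>\<^sup>+t. ennreal (?g y t) * indicator A t * indicator {x} t \<partial>\<mu>)" .
    qed
    also have "\<dots> = (\<integral>\<^sup>+t. ennreal (?g y t) * indicator A t \<partial>\<mu>)"
      by (rule nn_integral_countable_partition[OF C(1) Cm, symmetric]) measurable
    finally show "emeasure M {\<omega>\<in>space M. X \<omega> \<in> A \<and> Y \<omega> = y}
        = (\<integral>\<^sup>+x. ennreal (?g y x) * indicator A x \<partial>\<mu>)" .
  qed
  then show ?thesis .
qed

text \<open>The events \<open>X \<in> A\<close> make up the generated sigma-algebra, so the
  averaging property of the conditional probability over them yields the hypothesis
  \<open>joint\<close> of \<open>discrete_joint_density\<close>; nonnegativity is inherited from the
  conditional expectation, almost surely.\<close>

lemma continuous_discrete_joint_density: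
  assumes "discrete_rv M Y"
    and g [measurable]: "\<And>y. g y \<in> borel_measurable borel"
    and ce: "\<And>y. AE \<omega> in M. g y (X \<omega>) = real_cond_exp M (vimage_algebra (space M) X borel)
        (indicator {\<omega> \<in> space M. Y \<omega> = y}) \<omega>"
  shows "joint_density M X Y (\<lambda>(x, y). g y x / \<P>(\<omega> in M. Y \<omega> = y))"
proof -
  obtain D where D: "countable D" "AE \<omega> in M. Y \<omega> \<in> D"
    using assms by (auto simp: discrete_rv_def)
  let ?F = "vimage_algebra (space M) X borel"
  interpret F: finite_measure_subalgebra M ?F
  proof
    show "subalgebra M ?F"
      by (auto simp: subalgebra_def sets_vimage_algebra2)
  qed
  have pos: "AE \<omega> in M. 0 \<le> g y (X \<omega>)" for y
  proof -
    have "AE \<omega> in M. real_cond_exp M ?F (indicator {\<omega> \<in> space M. Y \<omega> = y}) \<omega> \<ge> 0"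
      by (rule F.real_cond_exp_pos) auto
    with ce[of y] show ?thesis by eventually_elim simp
  qed
  show ?thesis
  proof (rule discrete_joint_density[OF D g])
    show "AE x in \<mu>. 0 \<le> g y x" for y
      using pos[of y] by (simp add: AE_distr_iff)
    fix y :: real and A :: "real set" assume [measurable]: "A \<in> sets borel"
    let ?E = "{\<omega> \<in> space M. Y \<omega> = y}"
    let ?A = "X -` A \<inter> space M"
    have A: "?A \<in> sets ?F" by (rule in_vimage_algebra) simp
    have int: "integrable M (indicator ?E :: 'a \<Rightarrow> real)"
      by (intro integrable_real_indicator) (auto simp: emeasure_eq_measure)
    have ig: "integrable M (\<lambda>\<omega>. g y (X \<omega>))"
      using F.real_cond_exp_int(1)[OF int] by (rule integrable_cong_AE_imp) (use ce[of y] in \<open>auto elim: eventually_mono\<close>)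
    have "\<P>(\<omega> in M. X \<omega> \<in> A \<and> Y \<omega> = y) = (\<integral>\<omega>\<in>?A. indicator ?E \<omega> \<partial>M)"
    proof -
      have "(\<integral>\<omega>\<in>?A. indicator ?E \<omega> \<partial>M) = (\<integral>\<omega>. indicator {\<omega>\<in>space M. X \<omega> \<in> A \<and> Y \<omega> = y} \<omega> \<partial>M)"
        unfolding set_lebesgue_integral_def
        by (intro Bochner_Integration.integral_cong) (auto simp: indicator_def)
      also have "\<dots> = \<P>(\<omega> in M. X \<omega> \<in> A \<and> Y \<omega> = y)"
        unfolding Bochner_Integration.integral_indicator by (intro arg_cong[where f=prob]) auto
      finally show ?thesis by simp
    qed
    also have "\<dots> = (\<integral>\<omega>\<in>?A. real_cond_exp M ?F (indicator ?E) \<omega> \<partial>M)"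
      by (rule F.real_cond_exp_intA[OF int A])
    also have "\<dots> = (\<integral>\<omega>. g y (X \<omega>) * indicator A (X \<omega>) \<partial>M)"
      unfolding set_lebesgue_integral_def
    proof (rule integral_cong_AE)
      show "AE \<omega> in M. indicator ?A \<omega> *\<^sub>R real_cond_exp M ?F (indicator ?E) \<omega>
          = g y (X \<omega>) * indicator A (X \<omega>)"
        using ce[of y] AE_space by eventually_elim (auto simp: indicator_def)
    qed measurable
    finally have *: "\<P>(\<omega> in M. X \<omega> \<in> A \<and> Y \<omega> = y) = (\<integral>\<omega>. g y (X \<omega>) * indicator A (X \<omega>) \<partial>M)" .
    have "emeasure M {\<omega>\<in>space M. X \<omega> \<in> A \<and> Y \<omega> = y}
        = ennreal (\<integral>\<omega>. g y (X \<omega>) * indicator A (X \<omega>) \<partial>M)"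
      by (simp add: emeasure_eq_measure *)
    also have "\<dots> = (\<integral>\<^sup>+\<omega>. ennreal (g y (X \<omega>) * indicator A (X \<omega>)) \<partial>M)"
    proof (rule nn_integral_eq_integral[symmetric])
      show "integrable M (\<lambda>\<omega>. g y (X \<omega>) * indicator A (X \<omega>))"
        by (rule Bochner_Integration.integrable_bound[OF ig]) (auto simp: indicator_def)
      show "AE \<omega> in M. 0 \<le> g y (X \<omega>) * indicator A (X \<omega>)"
        using pos[of y] by eventually_elim simp
    qed
    also have "\<dots> = (\<integral>\<^sup>+x. ennreal (g y x) * indicator A x \<partial>\<mu>)"
      by (subst nn_integral_distr) (auto intro!: nn_integral_cong simp: indicator_def)
    finally show "emeasure M {\<omega>\<in>space M. X \<omega> \<in> A \<and> Y \<omega> = y}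
        = (\<integral>\<^sup>+x. ennreal (g y x) * indicator A x \<partial>\<mu>)" .
  qed
qed

text \<open>The product of the marginal densities cancels only where both are positive. Almost
  surely \<open>(X, Y)\<close> stays in that region, so \<open>f\<close> vanishes almost everywhere
  outside it and the equality persists.\<close>

lemma continuous_continuous_joint_density:
  assumes f: "is_density M (lborel \<Otimes>\<^sub>M lborel) (\<lambda>\<omega>. (X \<omega>, Y \<omega>)) f"
    and fX: "is_density M lborel X fX" and fY: "is_density M lborel Y fY"
  shows "joint_density M X Y (\<lambda>(x, y). (f (x, y) / fX x) / fY y)"
proof -
  let ?c = "\<lambda>(x, y). (f (x, y) / fX x) / fY y"
  have nn: "0 \<le> f z" "0 \<le> fX x" "0 \<le> fY x" for z x
    using assms unfolding is_density_def by blast+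
  \<comment> \<open>Densities are given as measurable into \<open>ennreal\<close>; for nonnegative
    functions \<open>enn2real\<close> recovers real measurability.\<close>
  have real: "h \<in> borel_measurable N" if "(\<lambda>x. ennreal (h x)) \<in> borel_measurable N" "\<And>x. 0 \<le> h x"
    for h and N :: "'z measure"
  proof -
    have "(\<lambda>x. enn2real (ennreal (h x))) \<in> borel_measurable N" using that(1) by measurable
    then show ?thesis using that(2) by simp
  qed
  have [measurable]: "fX \<in> borel_measurable borel" "fY \<in> borel_measurable borel"
      "f \<in> borel_measurable (borel \<Otimes>\<^sub>M borel)"
    using assms nn by (auto simp: is_density_def distributed_def lborel_prod borel_prod intro!: real)
  have mu: "\<mu> = density lborel (\<lambda>x. ennreal (fX x))" and nu: "\<nu> = density lborel (\<lambda>x. ennreal (fY x))"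
    and fd: "distr M (borel \<Otimes>\<^sub>M borel) (\<lambda>\<omega>. (X \<omega>, Y \<omega>)) = density (lborel \<Otimes>\<^sub>M lborel) (\<lambda>z. ennreal (f z))"
  proof -
    have "\<mu> = distr M lborel X" "\<nu> = distr M lborel Y"
      by (auto intro: distr_cong)
    then show "\<mu> = density lborel (\<lambda>x. ennreal (fX x))" "\<nu> = density lborel (\<lambda>x. ennreal (fY x))"
      using fX fY by (simp_all add: is_density_def distributed_def)
    have "distr M (borel \<Otimes>\<^sub>M borel) (\<lambda>\<omega>. (X \<omega>, Y \<omega>)) = distr M (lborel \<Otimes>\<^sub>M lborel) (\<lambda>\<omega>. (X \<omega>, Y \<omega>))"
      by (intro distr_cong sets_pair_measure_cong) auto
    then show "distr M (borel \<Otimes>\<^sub>M borel) (\<lambda>\<omega>. (X \<omega>, Y \<omega>)) = density (lborel \<Otimes>\<^sub>M lborel) (\<lambda>z. ennreal (f z))"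
      using f by (simp add: is_density_def distributed_def)
  qed
  have "\<mu> \<Otimes>\<^sub>M \<nu> = density (lborel \<Otimes>\<^sub>M lborel) (\<lambda>(x, y). ennreal (fX x) * ennreal (fY y))"
    unfolding mu nu
    by (intro pair_measure_density)
      (use nu.sigma_finite_measure_axioms nu in \<open>auto simp: lborel.sigma_finite_measure_axioms\<close>)
  then have "density (\<mu> \<Otimes>\<^sub>M \<nu>) (\<lambda>z. ennreal (?c z))
      = density (lborel \<Otimes>\<^sub>M lborel) (\<lambda>z. (case z of (x, y) \<Rightarrow> ennreal (fX x) * ennreal (fY y)) * ennreal (?c z))"
    by (simp add: density_density_eq split_beta')
  also have "\<dots> = density (lborel \<Otimes>\<^sub>M lborel) (\<lambda>z. ennreal (f z))"
  proof (rule density_cong)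
    have "AE x in \<mu>. fX x \<noteq> 0" unfolding mu by (subst AE_density) auto
    then have "AE \<omega> in M. fX (X \<omega>) \<noteq> 0" by (simp add: AE_distr_iff)
    moreover have "AE x in \<nu>. fY x \<noteq> 0" unfolding nu by (subst AE_density) auto
    then have "AE \<omega> in M. fY (Y \<omega>) \<noteq> 0" by (simp add: AE_distr_iff)
    ultimately have "AE \<omega> in M. fX (X \<omega>) \<noteq> 0 \<and> fY (Y \<omega>) \<noteq> 0" by eventually_elim simp
    then have "AE z in distr M (borel \<Otimes>\<^sub>M borel) (\<lambda>\<omega>. (X \<omega>, Y \<omega>)). fX (fst z) \<noteq> 0 \<and> fY (snd z) \<noteq> 0"
      by (subst AE_distr_iff) auto
    then have "AE z in lborel \<Otimes>\<^sub>M lborel. 0 < ennreal (f z) \<longrightarrow> fX (fst z) \<noteq> 0 \<and> fY (snd z) \<noteq> 0"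
      unfolding fd by (subst (asm) AE_density) auto
    then show "AE z in lborel \<Otimes>\<^sub>M lborel.
        (case z of (x, y) \<Rightarrow> ennreal (fX x) * ennreal (fY y)) * ennreal (?c z) = ennreal (f z)"
    proof eventually_elim
      case (elim z)
      obtain x y where z: "z = (x, y)" by (cases z)
      show ?case
      proof (cases "f z = 0")
        case False
        then have "fX x \<noteq> 0" "fY y \<noteq> 0" using elim nn(1)[of z] by (auto simp: z less_le)
        then show ?thesis using nn
          by (simp add: z ennreal_mult[symmetric])
      qed (simp add: z)
    qed
  qed measurable
  finally have "density (\<mu> \<Otimes>\<^sub>M \<nu>) (\<lambda>z. ennreal (?c z)) = distr M (borel \<Otimes>\<^sub>M borel) (\<lambda>\<omega>. (X \<omega>, Y \<omega>))"
    by (simp add: fd)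
  then show ?thesis unfolding joint_density_def using nn by (auto simp: split_beta')
qed

text \<open>Serves the mixed case where only the conditional density of \<open>X\<close> given
  \<open>Y\<close> yields a usable version.\<close>

lemma joint_density_swap:
  assumes "joint_density M Y X c"
  shows "joint_density M X Y (\<lambda>(x, y). c (y, x))"
proof -
  interpret Q: pair_prob_space \<nu> \<mu> ..
  have sQ [measurable_cong]: "sets (\<nu> \<Otimes>\<^sub>M \<mu>) = sets (borel \<Otimes>\<^sub>M borel)"
    by (intro sets_pair_measure_cong) auto
  have [measurable]: "c \<in> borel_measurable (borel \<Otimes>\<^sub>M borel)"
    and pos: "AE z in \<nu> \<Otimes>\<^sub>M \<mu>. 0 \<le> c z"
    and eq: "distr M (borel \<Otimes>\<^sub>M borel) (\<lambda>\<omega>. (Y \<omega>, X \<omega>)) = density (\<nu> \<Otimes>\<^sub>M \<mu>) (\<lambda>z. ennreal (c z))"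
    using assms by (auto simp: joint_density_def)
  have swap: "\<nu> \<Otimes>\<^sub>M \<mu> = distr (\<mu> \<Otimes>\<^sub>M \<nu>) (\<nu> \<Otimes>\<^sub>M \<mu>) (\<lambda>(x, y). (y, x))"
    by (rule Q.distr_pair_swap)
  have swap': "\<mu> \<Otimes>\<^sub>M \<nu> = distr (\<nu> \<Otimes>\<^sub>M \<mu>) (\<mu> \<Otimes>\<^sub>M \<nu>) (\<lambda>(x, y). (y, x))"
    by (rule P.distr_pair_swap)
  have "AE z in distr (\<mu> \<Otimes>\<^sub>M \<nu>) (\<nu> \<Otimes>\<^sub>M \<mu>) (\<lambda>(x, y). (y, x)). 0 \<le> c z"
    by (subst swap[symmetric]) (rule pos)
  then have "AE z in \<mu> \<Otimes>\<^sub>M \<nu>. 0 \<le> (case z of (x, y) \<Rightarrow> c (y, x))"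
    by (auto dest!: AE_distrD[rotated] simp: split_beta')
  moreover have "distr M (borel \<Otimes>\<^sub>M borel) (\<lambda>\<omega>. (X \<omega>, Y \<omega>))
      = density (\<mu> \<Otimes>\<^sub>M \<nu>) (\<lambda>z. ennreal (case z of (x, y) \<Rightarrow> c (y, x)))"
  proof -
    have "distr M (borel \<Otimes>\<^sub>M borel) (\<lambda>\<omega>. (X \<omega>, Y \<omega>))
        = distr (distr M (borel \<Otimes>\<^sub>M borel) (\<lambda>\<omega>. (Y \<omega>, X \<omega>))) (borel \<Otimes>\<^sub>M borel) (\<lambda>(x, y). (y, x))"
      by (subst distr_distr) (auto simp: comp_def)
    also have "\<dots> = distr (density (\<nu> \<Otimes>\<^sub>M \<mu>) (\<lambda>z. ennreal (c z))) (\<mu> \<Otimes>\<^sub>M \<nu>) (\<lambda>(x, y). (y, x))"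
      unfolding eq by (rule distr_cong) (auto simp: sets_P)
    also have "\<dots> = density (distr (\<nu> \<Otimes>\<^sub>M \<mu>) (\<mu> \<Otimes>\<^sub>M \<nu>) (\<lambda>(x, y). (y, x)))
        (\<lambda>z. ennreal (case z of (x, y) \<Rightarrow> c (y, x)))"
      by (subst density_distr) (auto simp: split_beta')
    finally show ?thesis unfolding swap'[symmetric] .
  qed
  ultimately show ?thesis unfolding joint_density_def by simp
qed

text \<open>A countable set is Lebesgue null and cannot carry a law with a density. This keeps the
  exceptional alternative of \<open>cond_comparison_density_cases\<close> from occurring in both
  directions at once.\<close>

lemma not_discrete_and_continuous: "discrete_rv M X \<Longrightarrow> is_density M lborel X h \<Longrightarrow> False"
proof -
  assume "discrete_rv M X" "is_density M lborel X h"
  then obtain D where D: "countable D" "AE \<omega> in M. X \<omega> \<in> D"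
    and h: "distr M lborel X = density lborel (\<lambda>x. ennreal (h x))"
      "(\<lambda>x. ennreal (h x)) \<in> borel_measurable lborel"
    by (auto simp: discrete_rv_def is_density_def distributed_def)
  have "D \<in> null_sets lborel" by (rule countable_imp_null_set_lborel[OF D(1)])
  then have "emeasure (density lborel (\<lambda>x. ennreal (h x))) D = 0"
    using h(2) by (simp add: emeasure_density null_sets_def nn_integral_null_set)
  then have "emeasure M (X -` D \<inter> space M) = 0"
    unfolding h(1)[symmetric] using sets.countable[of D borel] D(1) by (simp add: emeasure_distr)
  moreover have "X -` D \<inter> space M \<in> sets M"
    using sets.countable[of D borel] D(1) by (intro measurable_sets[OF X_rv]) auto
  ultimately have "AE \<omega> in M. X \<omega> \<notin> D" by (intro AE_I[of _ _ "X -` D \<inter> space M"]) auto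
  with D(2) have "AE \<omega> in M. False" by eventually_elim simp
  then show False by simp
qed

lemma cond_comparison_density_cases:
  assumes "cond_comparison_density M X Y d"
  shows "(\<exists>c. joint_density M X Y c \<and> (\<forall>v x. d v x = c (x, quantile M Y v)))
    \<or> (discrete_rv M X \<and> (\<exists>h. is_density M lborel Y h))"
  using assms
proof cases
  case (continuous_continuous f fX fY)
  then show ?thesis using continuous_continuous_joint_density[of f fX fY] by fastforce
next
  case discrete_discrete
  then show ?thesis using discrete_discrete_joint_density by fastforce
next
  case (continuous_discrete fX g)
  then show ?thesis using continuous_discrete_joint_density[of g] by fastforce
next
  case (discrete_continuous fY h)
  then show ?thesis by blast
qed

end

text \<open>If \<open>X\<close> is discrete and \<open>Y\<close> continuous, the version \<open>dY\<close> is arbitrary wherever \<open>X\<close> has no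
  atom, so there the density is read off \<open>dX\<close> instead.\<close>

lemma copula_joint_density:
  assumes "two_rvs M X Y" "is_copula_density M X Y dY dX cop"
  obtains c where "joint_density M X Y c"
    "\<And>u v. 0 < u \<Longrightarrow> u < 1 \<Longrightarrow> 0 < v \<Longrightarrow> v < 1 \<Longrightarrow> cop u v = c (quantile M X u, quantile M Y v)"
proof -
  interpret XY: two_rvs M X Y by fact
  interpret YX: two_rvs M Y X
    by unfold_locales measurable
  have ccd: "cond_comparison_density M X Y dY" "cond_comparison_density M Y X dX"
    and cop: "\<And>u v. 0 < u \<Longrightarrow> u < 1 \<Longrightarrow> 0 < v \<Longrightarrow> v < 1 \<Longrightarrow> cop u v = dY v (quantile M X u)"
      "\<And>u v. 0 < u \<Longrightarrow> u < 1 \<Longrightarrow> 0 < v \<Longrightarrow> v < 1 \<Longrightarrow> cop u v = dX u (quantile M Y v)"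
    using assms(2) unfolding is_copula_density_def by blast+
  consider c where "joint_density M X Y c" "\<And>v x. dY v x = c (x, quantile M Y v)"
    | c where "joint_density M Y X c" "\<And>u y. dX u y = c (y, quantile M X u)"
    using XY.cond_comparison_density_cases[OF ccd(1)] YX.cond_comparison_density_cases[OF ccd(2)]
      XY.not_discrete_and_continuous by metis
  then show thesis
  proof cases
    case (1 c)
    then show thesis using cop(1) by (intro that[of c]) auto
  next
    case (2 c)
    then show thesis using cop(2) XY.joint_density_swap[OF 2(1)]
      by (intro that[of "\<lambda>(x, y). c (y, x)"]) auto
  qed
qed

subsection \<open>Completeness of the score functions\<close>

text \<open>Initial segments eventually contain any given finite subset, so unordered summation
  implies the ordinary limit of partial sums.\<close>

lemma filterlim_finite_subsets_atMost:
  "filterlim (\<lambda>m::nat. J \<inter> {..m}) (finite_subsets_at_top J) sequentially"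
  unfolding filterlim_iff eventually_finite_subsets_at_top
proof (intro allI impI)
  fix P assume "\<exists>A. finite A \<and> A \<subseteq> J \<and> (\<forall>B. finite B \<and> A \<subseteq> B \<and> B \<subseteq> J \<longrightarrow> P B)"
  then obtain A where A: "finite A" "A \<subseteq> J" "\<And>B. finite B \<Longrightarrow> A \<subseteq> B \<Longrightarrow> B \<subseteq> J \<Longrightarrow> P B"
    by auto
  show "\<forall>\<^sub>F m in sequentially. P (J \<inter> {..m})"
    using eventually_ge_at_top[of "Max (insert 0 A)"]
  proof eventually_elim
    case (elim m)
    then have "A \<subseteq> {..m}" using A(1) by auto
    then show ?case using A by auto
  qed
qed

context real_rv
begin

lemma score_L2: "L2_fun \<mu> (score M X j)"
proof -
  obtain C where "\<And>x. \<bar>score M X j x\<bar> \<le> C" using score_bounded by blast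
  then show ?thesis
    by (intro L2_fun_bounded[where C=C] law.finite_measure_axioms) auto
qed

lemma orthonormal_scores: "orthonormal_family \<mu> (score M X) (score_index M X)"
  by unfold_locales (simp_all add: score_L2 score_orthonormal)

lemma dense_scores: "dense_indicators \<mu> (score M X) (score_index M X)"
proof -
  interpret orthonormal_family \<mu> "score M X" "score_index M X" by (rule orthonormal_scores)
  show ?thesis
  proof
    show "sets \<mu> = sets borel" by simp
    show "(\<lambda>x. 1) \<in> cl"
      using closure_lincomb[of "{0}" "\<lambda>_. 1"] zero_in_index by (simp add: score_0)
    fix a :: real
    obtain f :: "nat \<Rightarrow> real \<Rightarrow> real" where f [measurable]: "\<And>n. f n \<in> borel_measurable borel"
      and fl: "\<And>n. score_lincomb (f n)" and fb: "\<And>n x. \<bar>f n x\<bar> \<le> 2"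
      and lim: "AE x in \<mu>. (\<lambda>n. f n x) \<longlonglongrightarrow> indicator {..a} x"
      using indicator_atMost_approx by blast
    show "indicator {..a} \<in> cl"
    proof (rule closure_dominated[OF _ _ _ lim, where w="\<lambda>x. 2"])
      show "f n \<in> cl" for n
      proof -
        obtain F b where F: "finite F" "F \<subseteq> score_index M X"
            "AE x in \<mu>. f n x = (\<Sum>i\<in>F. b i * score M X i x)"
          using fl[of n] unfolding score_lincomb_def by blast
        show ?thesis
          by (rule closure_AE_cong[OF closure_lincomb[OF F(1,2)]]) (use F(3) in \<open>auto elim: eventually_mono\<close>)
      qed
      show "L2_fun \<mu> (\<lambda>x. 2)"
        by (intro L2_fun_bounded[where C=2] law.finite_measure_axioms) auto
      show "AE x in \<mu>. \<bar>f n x\<bar> \<le> 2" for n using fb by simp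
    qed simp
  qed
qed

text \<open>The Christoffel-Darboux kernel of the law for polynomials in \<open>T_1\<close> of
  degree at most \<open>m\<close>.\<close>

definition score_kernel :: "real \<Rightarrow> nat \<Rightarrow> real \<Rightarrow> real" where
  "score_kernel x m t = (\<Sum>j\<in>score_index M X \<inter> {..m}. score M X j x * score M X j t)"

lemma score_kernel_measurable [measurable]: "score_kernel x m \<in> borel_measurable borel"
  unfolding score_kernel_def[abs_def] by measurable

lemma score_kernel_L2: "L2_fun \<mu> (score_kernel x m)"
  unfolding score_kernel_def[abs_def] by (intro L2_fun_sum L2_fun_cmult score_L2)

text \<open>Fourier expansion of the normalized indicator of the atom: its coefficient at
  \<open>T_j\<close> is \<open>T_j(x)\<close>, so the partial sums are the kernels
  themselves.\<close>

lemma score_kernel_tendsto: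
  assumes "measure \<mu> {x} \<noteq> 0"
  shows "(\<lambda>m. sq_dist \<mu> (\<lambda>t. indicator {x} t / measure \<mu> {x}) (score_kernel x m)) \<longlonglongrightarrow> 0"
proof -
  interpret orthonormal_family \<mu> "score M X" "score_index M X" by (rule orthonormal_scores)
  interpret D: dense_indicators \<mu> "score M X" "score_index M X" by (rule dense_scores)
  let ?g = "\<lambda>t. indicator {x} t / measure \<mu> {x}"
  have "L2_fun \<mu> ?g"
    by (rule L2_fun_bounded[where C="1 / measure \<mu> {x}", OF law.finite_measure_axioms])
      (auto simp: indicator_def)
  then have g: "?g \<in> cl" by (rule D.L2_in_closure)
  have coeff: "(\<integral>t. ?g t * score M X j t \<partial>\<mu>) = score M X j x" for j
  proof -
    have "(\<integral>t. ?g t * score M X j t \<partial>\<mu>) = (\<integral>t. score M X j x / measure \<mu> {x} * indicator {x} t \<partial>\<mu>)"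
      by (intro Bochner_Integration.integral_cong) (auto simp: indicator_def)
    also have "\<dots> = score M X j x / measure \<mu> {x} * measure \<mu> {x}"
      by (subst integral_mult_right_zero) simp
    finally show ?thesis using assms by simp
  qed
  have "((\<lambda>F. sq_dist \<mu> ?g (\<lambda>t. \<Sum>j\<in>F. score M X j x * score M X j t)) \<longlongrightarrow> 0)
      (finite_subsets_at_top (score_index M X))"
    using fourier_series_converges[OF g subset_refl] unfolding coeff by blast
  from filterlim_compose[OF this filterlim_finite_subsets_atMost]
  show ?thesis by (simp add: score_kernel_def[abs_def])
qed

text \<open>The infimum defining a quantile is meaningful only on the open unit interval. Extending
  by 0 gives a measurable map on the whole line, so that product measures can be formed from
  Lebesgue measure with a density rather than from restricted spaces.\<close>

definition quantile_ext :: "real \<Rightarrow> real" where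
  "quantile_ext u = (if u \<in> {0<..<1} then quantile M X u else 0)"

lemma quantile_ext_measurable [measurable]: "quantile_ext \<in> borel_measurable borel"
  unfolding quantile_ext_def[abs_def]
proof (subst measurable_If_restrict_space_iff)
  have "{u. u \<in> {0<..<1}} = {0<..<1::real}" by blast
  then show "quantile M X \<in> borel_measurable (restrict_space borel {u. u \<in> {0<..<1}})
      \<and> (\<lambda>u. 0) \<in> borel_measurable (restrict_space borel {u. u \<notin> {0<..<1}})"
    by (simp only: quantile_measurable) simp
qed simp

lemma distr_quantile_ext:
  "distr (density lborel (indicator {0<..<1})) borel quantile_ext = \<mu>"
proof -
  have "distr (density lborel (indicator {0<..<1})) borel quantile_ext
      = distr (restrict_space lborel {0<..<1}) borel (quantile M X)"
  proof (rule measure_eqI)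
    fix A assume "A \<in> sets (distr (density lborel (indicator {0<..<1})) borel quantile_ext)"
    then have A [measurable]: "A \<in> sets borel" by simp
    have q: "quantile M X \<in> borel_measurable (restrict_space lborel {0<..<1})"
      using quantile_measurable by (simp cong: measurable_cong_sets add: sets_restrict_space)
    have "emeasure (distr (density lborel (indicator {0<..<1})) borel quantile_ext) A
        = emeasure lborel ({0<..<1} \<inter> quantile_ext -` A)"
      using measurable_sets[OF quantile_ext_measurable A]
      by (subst emeasure_distr) (auto simp: emeasure_restricted)
    also have "{0<..<1} \<inter> quantile_ext -` A = quantile M X -` A \<inter> {0<..<1}"
      by (auto simp: quantile_ext_def)
    also have "emeasure lborel \<dots> = emeasure (distr (restrict_space lborel {0<..<1}) borel (quantile M X)) A"
      by (subst emeasure_distr[OF q A]) (simp add: emeasure_restrict_space space_restrict_space)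
    finally show "emeasure (distr (density lborel (indicator {0<..<1})) borel quantile_ext) A
        = emeasure (distr (restrict_space lborel {0<..<1}) borel (quantile M X)) A" .
  qed simp
  then show ?thesis by (simp only: distr_quantile)
qed

end

section \<open>Transfer between the unit square and the product of the laws\<close>

context two_rvs
begin

sublocale RX: real_rv M X by unfold_locales measurable
sublocale RY: real_rv M Y by unfold_locales measurable

abbreviation "J \<equiv> score_index M X"
abbreviation "K \<equiv> score_index M Y"

lemma AE_fst: "AE x in \<mu>. P x \<Longrightarrow> AE z in \<mu> \<Otimes>\<^sub>M \<nu>. P (fst z)"
  by (rule AE_distrD[of fst _ \<mu>]) (simp_all only: measurable_fst nu.distr_pair_fst)

lemma AE_snd:
  assumes "AE y in \<nu>. P y"
  shows "AE z in \<mu> \<Otimes>\<^sub>M \<nu>. P (snd z)"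
proof (rule AE_distrD[of snd _ \<nu>])
  have "distr (\<mu> \<Otimes>\<^sub>M \<nu>) \<nu> snd = \<nu>"
  proof (rule measure_eqI)
    fix A assume "A \<in> sets (distr (\<mu> \<Otimes>\<^sub>M \<nu>) \<nu> snd)"
    then have A: "A \<in> sets \<nu>" by simp
    have "emeasure (distr (\<mu> \<Otimes>\<^sub>M \<nu>) \<nu> snd) A = emeasure (\<mu> \<Otimes>\<^sub>M \<nu>) (space \<mu> \<times> A)"
      using A by (subst emeasure_distr)
        (auto simp: space_pair_measure intro!: arg_cong2[where f=emeasure])
    also have "\<dots> = emeasure \<nu> A"
      using A by (subst nu.emeasure_pair_measure_Times) (auto simp: mu.emeasure_space_1[simplified])
    finally show "emeasure (distr (\<mu> \<Otimes>\<^sub>M \<nu>) \<nu> snd) A = emeasure \<nu> A" .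
  qed simp
  then show "AE y in distr (\<mu> \<Otimes>\<^sub>M \<nu>) \<nu> snd. P y" using assms by (simp only:)
qed (rule measurable_snd)

text \<open>Two independent uniform variables: the image of a product measure under a product map is
  the product of the images.\<close>

lemma square_distr:
  "distr (density lborel (indicator unit_square)) (borel \<Otimes>\<^sub>M borel)
     (\<lambda>(u, v). (RX.quantile_ext u, RY.quantile_ext v)) = \<mu> \<Otimes>\<^sub>M \<nu>"
proof -
  let ?U = "density lborel (indicator {0<..<1::real})"
  interpret U: prob_space ?U
    by (rule prob_spaceI) (simp add: emeasure_density)
  have "\<mu> \<Otimes>\<^sub>M \<nu> = distr ?U borel RX.quantile_ext \<Otimes>\<^sub>M distr ?U borel RY.quantile_ext"
    by (simp only: RX.distr_quantile_ext RY.distr_quantile_ext)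
  also have "\<dots> = distr (?U \<Otimes>\<^sub>M ?U) (borel \<Otimes>\<^sub>M borel)
      (\<lambda>(u, v). (RX.quantile_ext u, RY.quantile_ext v))"
    by (rule pair_measure_distr) (simp_all add: RY.distr_quantile_ext nu.sigma_finite_measure_axioms)
  also have "?U \<Otimes>\<^sub>M ?U = density (lborel \<Otimes>\<^sub>M lborel) (\<lambda>(u, v). indicator {0<..<1} u * indicator {0<..<1} v)"
    by (rule pair_measure_density)
      (auto simp: lborel.sigma_finite_measure_axioms U.sigma_finite_measure_axioms)
  also have "(\<lambda>(u, v). indicator {0<..<1} u * indicator {0<..<1} v)
      = (indicator unit_square :: real \<times> real \<Rightarrow> ennreal)"
    by (auto simp: fun_eq_iff indicator_def)
  finally show ?thesis by (simp add: lborel_prod)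
qed

lemma unit_square_measurable [measurable]: "unit_square \<in> sets borel"
  by (intro borel_open open_Times) auto

text \<open>Transfer of integrals for a function \<open>F\<close> that is prescribed only on the
  open square. \<open>H\<close> is its measurable stand-in on the plane, and the indicator of the
  square makes the two interchangeable.\<close>

context
  fixes F h :: "real \<times> real \<Rightarrow> real"
  assumes h [measurable]: "h \<in> borel_measurable (borel \<Otimes>\<^sub>M borel)"
    and F: "\<And>u v. 0 < u \<Longrightarrow> u < 1 \<Longrightarrow> 0 < v \<Longrightarrow> v < 1 \<Longrightarrow> F (u, v) = h (quantile M X u, quantile M Y v)"
begin

abbreviation (input) "H \<equiv> \<lambda>z. h (case z of (u, v) \<Rightarrow> (RX.quantile_ext u, RY.quantile_ext v))"

lemma H_measurable: "H \<in> borel_measurable borel"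
  unfolding borel_prod[symmetric] by measurable

lemma F_eq_H: "z \<in> unit_square \<Longrightarrow> F z = H z"
  using F by (auto simp: RX.quantile_ext_def RY.quantile_ext_def)

lemma quantile_map_measurable:
  "(\<lambda>(u, v). (RX.quantile_ext u, RY.quantile_ext v))
     \<in> density lborel (indicator unit_square) \<rightarrow>\<^sub>M borel \<Otimes>\<^sub>M borel"
proof -
  have m: "(\<lambda>(u, v). (RX.quantile_ext u, RY.quantile_ext v)) \<in> borel \<Otimes>\<^sub>M borel \<rightarrow>\<^sub>M borel \<Otimes>\<^sub>M borel"
    by measurable
  have s: "sets (density lborel (indicator unit_square)) = sets (borel \<Otimes>\<^sub>M borel :: (real \<times> real) measure)"
    by (simp only: sets_density sets_lborel borel_prod)
  show ?thesis by (subst measurable_cong_sets[OF s refl]) (rule m)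
qed

lemma nn_integral_unit_square:
  "(\<integral>\<^sup>+z\<in>unit_square. ennreal (F z) \<partial>lborel) = (\<integral>\<^sup>+z. ennreal (h z) \<partial>(\<mu> \<Otimes>\<^sub>M \<nu>))"
proof -
  have "(\<integral>\<^sup>+z\<in>unit_square. ennreal (F z) \<partial>lborel) = (\<integral>\<^sup>+z. indicator unit_square z * ennreal (H z) \<partial>lborel)"
    by (intro nn_integral_cong) (auto simp: indicator_def F_eq_H)
  also have "\<dots> = (\<integral>\<^sup>+z. ennreal (H z) \<partial>density lborel (indicator unit_square))"
    using H_measurable by (subst nn_integral_density) auto
  also have "\<dots> = (\<integral>\<^sup>+z. ennreal (h z) \<partial>(\<mu> \<Otimes>\<^sub>M \<nu>))"
    unfolding square_distr[symmetric]
    by (subst nn_integral_distr[OF quantile_map_measurable]) auto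
  finally show ?thesis .
qed

lemma density_unit_square:
  "density lborel (indicator unit_square) = density lborel (\<lambda>z. ennreal (indicator unit_square z))"
  by (simp add: ennreal_indicator)

lemma set_integrable_unit_square:
  "set_integrable lborel unit_square F \<longleftrightarrow> integrable (\<mu> \<Otimes>\<^sub>M \<nu>) h"
proof -
  have "set_integrable lborel unit_square F
      \<longleftrightarrow> integrable lborel (\<lambda>z. indicator unit_square z *\<^sub>R H z)"
    unfolding set_integrable_def
    by (intro Bochner_Integration.integrable_cong) (auto simp: indicator_def F_eq_H)
  also have "\<dots> \<longleftrightarrow> integrable (density lborel (indicator unit_square)) H"
    using H_measurable unfolding density_unit_square by (subst integrable_density) auto
  also have "\<dots> \<longleftrightarrow> integrable (\<mu> \<Otimes>\<^sub>M \<nu>) h"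
    unfolding square_distr[symmetric]
    by (subst integrable_distr_eq[OF quantile_map_measurable]) auto
  finally show ?thesis .
qed

lemma set_integral_unit_square:
  "(LINT z:unit_square|lborel. F z) = (\<integral>z. h z \<partial>(\<mu> \<Otimes>\<^sub>M \<nu>))"
proof -
  have "(LINT z:unit_square|lborel. F z) = (\<integral>z. indicator unit_square z *\<^sub>R H z \<partial>lborel)"
    unfolding set_lebesgue_integral_def
    by (intro Bochner_Integration.integral_cong) (auto simp: indicator_def F_eq_H)
  also have "\<dots> = (\<integral>z. H z \<partial>density lborel (indicator unit_square))"
    using H_measurable unfolding density_unit_square by (subst integral_density) auto
  also have "\<dots> = (\<integral>z. h z \<partial>(\<mu> \<Otimes>\<^sub>M \<nu>))"
    unfolding square_distr[symmetric]
    by (subst integral_distr[OF quantile_map_measurable]) auto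
  finally show ?thesis .
qed

end

section \<open>Products of scores: orthonormality and completeness\<close>

definition tensor_score :: "nat \<times> nat \<Rightarrow> real \<times> real \<Rightarrow> real" where
  "tensor_score = (\<lambda>(j, k) (x, y). score M X j x * score M Y k y)"

lemma tensor_score_measurable [measurable]: "tensor_score i \<in> borel_measurable (borel \<Otimes>\<^sub>M borel)"
  unfolding tensor_score_def by (cases i) (simp add: split_beta')

lemma tensor_score_bounded: "\<exists>C. \<forall>z. \<bar>tensor_score i z\<bar> \<le> C"
proof -
  obtain j k where i: "i = (j, k)" by (cases i)
  obtain A B where AB: "\<And>x. \<bar>score M X j x\<bar> \<le> A" "\<And>y. \<bar>score M Y k y\<bar> \<le> B"
    using RX.score_bounded[of j] RY.score_bounded[of k] by blast
  then have "0 \<le> A" by (meson abs_ge_zero order_trans)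
  then have "\<bar>tensor_score i z\<bar> \<le> A * B" for z
    using AB by (auto simp: i tensor_score_def abs_mult split_beta' intro!: mult_mono)
  then show ?thesis by blast
qed

lemma tensor_score_L2: "L2_fun (\<mu> \<Otimes>\<^sub>M \<nu>) (tensor_score i)"
proof -
  obtain C where "\<And>z. \<bar>tensor_score i z\<bar> \<le> C" using tensor_score_bounded by blast
  then show ?thesis
    by (intro L2_fun_bounded[where C=C] P.finite_measure_axioms) auto
qed

lemma L2_const: "L2_fun (\<mu> \<Otimes>\<^sub>M \<nu>) (\<lambda>z. c)"
  by (intro L2_fun_bounded[where C="\<bar>c\<bar>"] P.finite_measure_axioms) auto

lemma integral_tensor:
  assumes "integrable (\<mu> \<Otimes>\<^sub>M \<nu>) (\<lambda>z. f (fst z) * g (snd z) :: real)"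
  shows "(\<integral>z. f (fst z) * g (snd z) \<partial>(\<mu> \<Otimes>\<^sub>M \<nu>)) = (\<integral>x. f x \<partial>\<mu>) * (\<integral>y. g y \<partial>\<nu>)"
  using P.integral_fst'[OF assms] by simp

lemma orthonormal_tensor: "orthonormal_family (\<mu> \<Otimes>\<^sub>M \<nu>) tensor_score (J \<times> K)"
proof
  fix i i' assume "i \<in> J \<times> K" "i' \<in> J \<times> K"
  then obtain j k j' k' where i: "i = (j, k)" "i' = (j', k')" "j \<in> J" "k \<in> K" "j' \<in> J" "k' \<in> K"
    by auto
  have eq: "tensor_score i z * tensor_score i' z = (score M X j (fst z) * score M X j' (fst z))
      * (score M Y k (snd z) * score M Y k' (snd z))" for z
    by (simp add: i tensor_score_def split_beta' mult_ac)
  have "integrable (\<mu> \<Otimes>\<^sub>M \<nu>) (\<lambda>z. tensor_score i z * tensor_score i' z)"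
    by (rule L2_fun_mult_integrable[OF tensor_score_L2 tensor_score_L2])
  then have "(\<integral>z. tensor_score i z * tensor_score i' z \<partial>(\<mu> \<Otimes>\<^sub>M \<nu>))
      = (\<integral>x. score M X j x * score M X j' x \<partial>\<mu>) * (\<integral>y. score M Y k y * score M Y k' y \<partial>\<nu>)"
    unfolding eq by (rule integral_tensor)
  then show "(\<integral>z. tensor_score i z * tensor_score i' z \<partial>(\<mu> \<Otimes>\<^sub>M \<nu>)) = (if i = i' then 1 else 0)"
    using i by (simp add: RX.score_orthonormal RY.score_orthonormal)
qed (rule tensor_score_L2)

text \<open>A quadrant is a product of half-lines, so the products of the approximating sequences
  converge to its indicator, dominated by 4, the product of the two bounds 2. Expanding a product of
  two combinations gives a combination over \<open>F \<times> G\<close>.\<close>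

lemma dense_tensor: "dense_indicators (\<mu> \<Otimes>\<^sub>M \<nu>) tensor_score (J \<times> K)"
proof -
  interpret orthonormal_family "\<mu> \<Otimes>\<^sub>M \<nu>" tensor_score "J \<times> K" by (rule orthonormal_tensor)
  show ?thesis
  proof
    show "sets (\<mu> \<Otimes>\<^sub>M \<nu>) = sets borel" by (simp only: sets_P borel_prod)
    show "(\<lambda>x. 1) \<in> cl"
      using closure_lincomb[of "{(0, 0)}" "\<lambda>_. 1"] RX.zero_in_index RY.zero_in_index
      by (simp add: RX.score_0 RY.score_0 tensor_score_def split_beta')
    fix a :: "real \<times> real"
    obtain f :: "nat \<Rightarrow> real \<Rightarrow> real" where f [measurable]: "\<And>n. f n \<in> borel_measurable borel"
      and fl: "\<And>n. RX.score_lincomb (f n)" and fb: "\<And>n x. \<bar>f n x\<bar> \<le> 2"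
      and flim: "AE x in \<mu>. (\<lambda>n. f n x) \<longlonglongrightarrow> indicator {..fst a} x"
      using RX.indicator_atMost_approx by blast
    obtain g :: "nat \<Rightarrow> real \<Rightarrow> real" where g [measurable]: "\<And>n. g n \<in> borel_measurable borel"
      and gl: "\<And>n. RY.score_lincomb (g n)" and gb: "\<And>n x. \<bar>g n x\<bar> \<le> 2"
      and glim: "AE x in \<nu>. (\<lambda>n. g n x) \<longlonglongrightarrow> indicator {..snd a} x"
      using RY.indicator_atMost_approx by blast
    have ind: "indicator {..a} z = indicator {..fst a} (fst z) * (indicator {..snd a} (snd z) :: real)" for z
      by (auto simp: indicator_def less_eq_prod_def)
    have "(\<lambda>z. indicator {..fst a} (fst z) * indicator {..snd a} (snd z)) \<in> cl"
    proof (rule closure_dominated[where w="\<lambda>x. 4" and f="\<lambda>n z. f n (fst z) * g n (snd z)"])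
      show "(\<lambda>z. f n (fst z) * g n (snd z)) \<in> cl" for n
      proof -
        obtain F b where F: "finite F" "F \<subseteq> J" "AE x in \<mu>. f n x = (\<Sum>i\<in>F. b i * score M X i x)"
          using fl[of n] unfolding RX.score_lincomb_def by blast
        obtain G d where G: "finite G" "G \<subseteq> K" "AE x in \<nu>. g n x = (\<Sum>i\<in>G. d i * score M Y i x)"
          using gl[of n] unfolding RY.score_lincomb_def by blast
        have comb: "(\<lambda>z. \<Sum>i\<in>F \<times> G. (b (fst i) * d (snd i)) * tensor_score i z) \<in> cl"
          using F G by (intro closure_lincomb) auto
        have "AE z in \<mu> \<Otimes>\<^sub>M \<nu>.
            (\<Sum>i\<in>F \<times> G. (b (fst i) * d (snd i)) * tensor_score i z) = f n (fst z) * g n (snd z)"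
          using AE_fst[OF F(3)] AE_snd[OF G(3)]
        proof eventually_elim
          case (elim z)
          show ?case
            unfolding elim sum_product sum.cartesian_product
            by (intro sum.cong) (auto simp: tensor_score_def split_beta' mult_ac)
        qed
        then show ?thesis by (intro closure_AE_cong[OF comb]) measurable
      qed
      show "AE z in \<mu> \<Otimes>\<^sub>M \<nu>. (\<lambda>n. f n (fst z) * g n (snd z))
          \<longlonglongrightarrow> indicator {..fst a} (fst z) * indicator {..snd a} (snd z)"
        using AE_fst[OF flim] AE_snd[OF glim] by eventually_elim (rule tendsto_mult)
      show "AE z in \<mu> \<Otimes>\<^sub>M \<nu>. \<bar>f n (fst z) * g n (snd z)\<bar> \<le> 4" for n
      proof (rule AE_I2)
        show "\<bar>f n (fst z) * g n (snd z)\<bar> \<le> 4" for z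
          using mult_mono[OF fb[of n "fst z"] gb[of n "snd z"]] by (simp add: abs_mult)
      qed
    qed (measurable, rule L2_const)
    then show "indicator {..a} \<in> cl" unfolding ind[abs_def, symmetric] .
  qed
qed

end

subsection \<open>The expansion of the copula density\<close>

context two_rvs
begin

lemma LP_comoment_eq_tensor: "LP_comoment M j k X Y = (\<integral>\<omega>. tensor_score (j, k) (X \<omega>, Y \<omega>) \<partial>M)"
  by (simp add: LP_comoment_def tensor_score_def)

text \<open>Comoments with an index 0 involve at most one variable, since \<open>T_0 = 1\<close>,
  and reduce to orthonormality under its law. These are the terms accounted for by subtracting 1
  from the copula density.\<close>

lemma LP_comoment_zero:
  assumes "j \<in> J" "k \<in> K"
  shows "LP_comoment M 0 k X Y = (if k = 0 then 1 else 0)"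
    "LP_comoment M j 0 X Y = (if j = 0 then 1 else 0)"
proof -
  have "LP_comoment M 0 k X Y = (\<integral>y. score M Y 0 y * score M Y k y \<partial>\<nu>)"
    by (simp add: LP_comoment_def RX.score_0 RY.score_0 integral_distr)
  then show "LP_comoment M 0 k X Y = (if k = 0 then 1 else 0)"
    using RY.score_orthonormal[OF RY.zero_in_index assms(2)] by simp
  have "LP_comoment M j 0 X Y = (\<integral>y. score M X 0 y * score M X j y \<partial>\<mu>)"
    by (simp add: LP_comoment_def RX.score_0 RY.score_0 integral_distr)
  then show "LP_comoment M j 0 X Y = (if j = 0 then 1 else 0)"
    using RX.score_orthonormal[OF RX.zero_in_index assms(1)] by simp
qed

lemma tensor_score_integral:
  assumes "i \<in> J \<times> K"
  shows "(\<integral>z. tensor_score i z \<partial>(\<mu> \<Otimes>\<^sub>M \<nu>)) = (if i = (0, 0) then 1 else 0)"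
proof -
  interpret orthonormal_family "\<mu> \<Otimes>\<^sub>M \<nu>" tensor_score "J \<times> K" by (rule orthonormal_tensor)
  have "tensor_score (0, 0) z = 1" for z
    by (simp add: RX.score_0 RY.score_0 tensor_score_def split_beta')
  then show ?thesis
    using orthonormal[OF assms, of "(0, 0)"] RX.zero_in_index RY.zero_in_index by simp
qed

text \<open>The kernels also contain index 0, which the series omits. Of the terms with an index 0
  only the pair \<open>(0, 0)\<close> survives, and it equals 1.\<close>

lemma score_kernel_sum:
  assumes "x = quantile M X u" "y = quantile M Y v"
  shows "(\<Sum>j \<in> J \<inter> {1..m}. \<Sum>k \<in> K \<inter> {1..n}.
      LP_comoment M j k X Y * quantile_score M X j u * quantile_score M Y k v)
    = (\<integral>\<omega>. RX.score_kernel x m (X \<omega>) * RY.score_kernel y n (Y \<omega>) \<partial>M) - 1"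
proof -
  let ?t = "\<lambda>j k. score M X j x * score M Y k y * LP_comoment M j k X Y"
  have int: "integrable M (\<lambda>\<omega>. score M X j (X \<omega>) * score M Y k (Y \<omega>))" for j k
  proof -
    obtain C where C: "\<And>z. \<bar>tensor_score (j, k) z\<bar> \<le> C" using tensor_score_bounded by blast
    have "\<bar>score M X j (X \<omega>) * score M Y k (Y \<omega>)\<bar> \<le> C" for \<omega>
      using C[of "(X \<omega>, Y \<omega>)"] by (simp add: tensor_score_def)
    then show ?thesis by (intro integrable_const_bound[where B=C]) auto
  qed
  have "(\<integral>\<omega>. RX.score_kernel x m (X \<omega>) * RY.score_kernel y n (Y \<omega>) \<partial>M)
      = (\<integral>\<omega>. (\<Sum>j\<in>J \<inter> {..m}. \<Sum>k\<in>K \<inter> {..n}. score M X j x * score M Y k y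
          * (score M X j (X \<omega>) * score M Y k (Y \<omega>))) \<partial>M)"
    unfolding RX.score_kernel_def RY.score_kernel_def sum_product by (simp add: mult_ac)
  also have "\<dots> = (\<Sum>j\<in>J \<inter> {..m}. \<Sum>k\<in>K \<inter> {..n}. ?t j k)"
    using int by (simp add: LP_comoment_def)
  also have "J \<inter> {..m} = insert 0 (J \<inter> {1..m})"
    using RX.zero_in_index by (auto simp: not_less_eq_eq)
  also have "K \<inter> {..n} = insert 0 (K \<inter> {1..n})"
    using RY.zero_in_index by (auto simp: not_less_eq_eq)
  also have "(\<Sum>j\<in>insert 0 (J \<inter> {1..m}). \<Sum>k\<in>insert 0 (K \<inter> {1..n}). ?t j k)
      = 1 + (\<Sum>j\<in>J \<inter> {1..m}. \<Sum>k\<in>K \<inter> {1..n}. ?t j k)"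
  proof -
    have "(\<Sum>k\<in>K \<inter> {1..n}. ?t 0 k) = 0"
      using LP_comoment_zero(1)[OF RX.zero_in_index] by (intro sum.neutral) auto
    moreover have "(\<Sum>j\<in>J \<inter> {1..m}. ?t j 0) = 0"
      using LP_comoment_zero(2)[OF _ RY.zero_in_index] by (intro sum.neutral) auto
    moreover have "?t 0 0 = 1"
      using LP_comoment_zero(1)[OF RX.zero_in_index RY.zero_in_index] by (simp add: RX.score_0 RY.score_0)
    ultimately show ?thesis by (simp add: sum.distrib)
  qed
  finally show ?thesis by (simp add: quantile_score_def assms mult_ac)
qed

text \<open>Nonnegativity of the variance of \<open>Z W\<close> bounds the squared mean by the mean
  square; the bound of \<open>W\<close> is then pulled out.\<close>

lemma expectation_mult_sq_le:
  assumes "L2_fun M Z" "W \<in> borel_measurable M" "\<And>\<omega>. \<bar>W \<omega>\<bar> \<le> B"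
  shows "(\<integral>\<omega>. Z \<omega> * W \<omega> \<partial>M)\<^sup>2 \<le> B\<^sup>2 * (\<integral>\<omega>. (Z \<omega>)\<^sup>2 \<partial>M)"
proof -
  have Z [measurable]: "Z \<in> borel_measurable M" "integrable M (\<lambda>\<omega>. (Z \<omega>)\<^sup>2)"
    using assms(1) by (auto simp: L2_fun_def)
  note assms(2) [measurable]
  have W: "L2_fun M W" using assms by (intro L2_fun_bounded[where C=B] finite_measure_axioms) auto
  have le: "(Z \<omega> * W \<omega>)\<^sup>2 \<le> B\<^sup>2 * (Z \<omega>)\<^sup>2" for \<omega>
  proof -
    have "(W \<omega>)\<^sup>2 \<le> B\<^sup>2"
      using assms(3)[of \<omega>] by (simp add: abs_le_square_iff[symmetric])
    moreover have "(Z \<omega> * W \<omega>)\<^sup>2 = (W \<omega>)\<^sup>2 * (Z \<omega>)\<^sup>2"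
      by (simp add: power_mult_distrib mult.commute)
    ultimately show ?thesis
      by (simp add: mult_right_mono)
  qed
  have int: "integrable M (\<lambda>\<omega>. (Z \<omega> * W \<omega>)\<^sup>2)"
    by (rule Bochner_Integration.integrable_bound[where f="\<lambda>\<omega>. B\<^sup>2 * (Z \<omega>)\<^sup>2"]) (use Z le in auto)
  have "0 \<le> variance (\<lambda>\<omega>. Z \<omega> * W \<omega>)" by (rule variance_positive)
  also have "\<dots> = (\<integral>\<omega>. (Z \<omega> * W \<omega>)\<^sup>2 \<partial>M) - (\<integral>\<omega>. Z \<omega> * W \<omega> \<partial>M)\<^sup>2"
    by (rule variance_eq[OF L2_fun_mult_integrable[OF assms(1) W] int])
  finally have "(\<integral>\<omega>. Z \<omega> * W \<omega> \<partial>M)\<^sup>2 \<le> (\<integral>\<omega>. (Z \<omega> * W \<omega>)\<^sup>2 \<partial>M)" by simp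
  also have "\<dots> \<le> (\<integral>\<omega>. B\<^sup>2 * (Z \<omega>)\<^sup>2 \<partial>M)"
    by (rule integral_mono[OF int _ le]) (use Z in simp)
  finally show ?thesis by simp
qed

text \<open>Convergence of the product needs only \<open>L\<^sup>2\<close> convergence of each factor, because the
  marginal laws of \<open>(X, Y)\<close> are \<open>\<mu>\<close> and \<open>\<nu>\<close>; no bound on the joint density is involved.\<close>

lemma expectation_product_tendsto:
  fixes f g :: "nat \<Rightarrow> real \<Rightarrow> real"
  assumes f: "\<And>m. L2_fun \<mu> (f m)" "(\<lambda>m. sq_dist \<mu> k (f m)) \<longlonglongrightarrow> 0"
    and g: "\<And>n. L2_fun \<nu> (g n)" "(\<lambda>n. sq_dist \<nu> l (g n)) \<longlonglongrightarrow> 0"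
    and [measurable]: "k \<in> borel_measurable borel" "l \<in> borel_measurable borel"
    and A: "\<And>x. \<bar>k x\<bar> \<le> A" and B: "\<And>x. \<bar>l x\<bar> \<le> B"
  shows "((\<lambda>(m, n). \<integral>\<omega>. f m (X \<omega>) * g n (Y \<omega>) \<partial>M) \<longlongrightarrow> (\<integral>\<omega>. k (X \<omega>) * l (Y \<omega>) \<partial>M))
    (sequentially \<times>\<^sub>F sequentially)"
proof -
  \<comment> \<open>With the deviations \<open>U\<close> and \<open>V\<close>,
    \<open>f g - k l = U V + U l + V k\<close>; the three terms tend to 0 separately.\<close>
  let ?U = "\<lambda>m \<omega>. f m (X \<omega>) - k (X \<omega>)" and ?V = "\<lambda>n \<omega>. g n (Y \<omega>) - l (Y \<omega>)"
  have fm [measurable]: "f m \<in> borel_measurable borel" for m using f(1)[of m] by (simp add: L2_fun_def)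
  have gm [measurable]: "g n \<in> borel_measurable borel" for n using g(1)[of n] by (simp add: L2_fun_def)
  have kL: "L2_fun \<mu> k" by (intro L2_fun_bounded[where C=A] mu.finite_measure_axioms) (use A in auto)
  have lL: "L2_fun \<nu> l" by (intro L2_fun_bounded[where C=B] nu.finite_measure_axioms) (use B in auto)
  have kM: "L2_fun M (\<lambda>\<omega>. k (X \<omega>))" by (intro L2_fun_bounded[where C=A] finite_measure_axioms) (use A in auto)
  have lM: "L2_fun M (\<lambda>\<omega>. l (Y \<omega>))" by (intro L2_fun_bounded[where C=B] finite_measure_axioms) (use B in auto)
  have U: "L2_fun M (?U m)" for m
    using L2_fun_diff[OF f(1) kL, of m] by (simp add: L2_fun_def integrable_distr_eq)
  have V: "L2_fun M (?V n)" for n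
    using L2_fun_diff[OF g(1) lL, of n] by (simp add: L2_fun_def integrable_distr_eq)
  have U2: "(\<integral>\<omega>. (?U m \<omega>)\<^sup>2 \<partial>M) = sq_dist \<mu> k (f m)" for m
    by (simp add: sq_dist_def integral_distr power2_commute)
  have V2: "(\<integral>\<omega>. (?V n \<omega>)\<^sup>2 \<partial>M) = sq_dist \<nu> l (g n)" for n
    by (simp add: sq_dist_def integral_distr power2_commute)
  have le_sqrt: "norm a \<le> norm (sqrt b) * 1" if "a\<^sup>2 \<le> b" for a b :: real
  proof -
    have "\<bar>a\<bar> \<le> sqrt b" using that by (intro real_le_rsqrt) simp
    then show ?thesis by simp
  qed
  have T1: "(\<lambda>m. \<integral>\<omega>. ?U m \<omega> * l (Y \<omega>) \<partial>M) \<longlonglongrightarrow> 0"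
  proof (rule tendsto_0_le[where K=1])
    show "(\<lambda>m. sqrt (B\<^sup>2 * sq_dist \<mu> k (f m))) \<longlonglongrightarrow> 0"
      using tendsto_real_sqrt[OF tendsto_mult_right_zero[OF f(2), of "B\<^sup>2"]] by simp
    show "\<forall>\<^sub>F m in sequentially. norm (\<integral>\<omega>. ?U m \<omega> * l (Y \<omega>) \<partial>M)
        \<le> norm (sqrt (B\<^sup>2 * sq_dist \<mu> k (f m))) * 1"
      using expectation_mult_sq_le[OF U, of "\<lambda>\<omega>. l (Y \<omega>)" B] B
      by (intro always_eventually allI) (rule le_sqrt, simp add: U2)
  qed
  have T2: "(\<lambda>n. \<integral>\<omega>. ?V n \<omega> * k (X \<omega>) \<partial>M) \<longlonglongrightarrow> 0"
  proof (rule tendsto_0_le[where K=1])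
    show "(\<lambda>n. sqrt (A\<^sup>2 * sq_dist \<nu> l (g n))) \<longlonglongrightarrow> 0"
      using tendsto_real_sqrt[OF tendsto_mult_right_zero[OF g(2), of "A\<^sup>2"]] by simp
    show "\<forall>\<^sub>F n in sequentially. norm (\<integral>\<omega>. ?V n \<omega> * k (X \<omega>) \<partial>M)
        \<le> norm (sqrt (A\<^sup>2 * sq_dist \<nu> l (g n))) * 1"
      using expectation_mult_sq_le[OF V, of "\<lambda>\<omega>. k (X \<omega>)" A] A
      by (intro always_eventually allI) (rule le_sqrt, simp add: V2)
  qed
  note fst_lim = filterlim_fst[of sequentially sequentially]
  note snd_lim = filterlim_snd[of sequentially sequentially]
  \<comment> \<open>The estimate \<open>\<bar>U V\<bar> \<le> U^2 + V^2\<close> separates the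
    variables, so that each square is integrated under its own marginal law, whatever the dependence
    of \<open>X\<close> and \<open>Y\<close>.\<close>
  have T3: "((\<lambda>p. \<integral>\<omega>. ?U (fst p) \<omega> * ?V (snd p) \<omega> \<partial>M) \<longlongrightarrow> 0) (sequentially \<times>\<^sub>F sequentially)"
  proof (rule tendsto_0_le[where K=1])
    show "((\<lambda>p. sq_dist \<mu> k (f (fst p)) + sq_dist \<nu> l (g (snd p))) \<longlongrightarrow> 0) (sequentially \<times>\<^sub>F sequentially)"
      using tendsto_add[OF filterlim_compose[OF f(2) fst_lim] filterlim_compose[OF g(2) snd_lim]] by simp
    have "\<bar>\<integral>\<omega>. ?U m \<omega> * ?V n \<omega> \<partial>M\<bar> \<le> sq_dist \<mu> k (f m) + sq_dist \<nu> l (g n)" for m n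
    proof -
      have "\<bar>\<integral>\<omega>. ?U m \<omega> * ?V n \<omega> \<partial>M\<bar> \<le> (\<integral>\<omega>. \<bar>?U m \<omega> * ?V n \<omega>\<bar> \<partial>M)"
        by (rule integral_abs_bound)
      also have "\<dots> \<le> (\<integral>\<omega>. (?U m \<omega>)\<^sup>2 + (?V n \<omega>)\<^sup>2 \<partial>M)"
      proof (rule integral_mono)
        show "integrable M (\<lambda>\<omega>. \<bar>?U m \<omega> * ?V n \<omega>\<bar>)"
          by (intro integrable_abs L2_fun_mult_integrable U V)
        show "integrable M (\<lambda>\<omega>. (?U m \<omega>)\<^sup>2 + (?V n \<omega>)\<^sup>2)"
          using U V by (simp add: L2_fun_def)
        show "\<bar>a * b\<bar> \<le> a\<^sup>2 + b\<^sup>2" for a b :: real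
          by (rule abs_mult_le_sum_squares)
      qed
      also have "\<dots> = (\<integral>\<omega>. (?U m \<omega>)\<^sup>2 \<partial>M) + (\<integral>\<omega>. (?V n \<omega>)\<^sup>2 \<partial>M)"
        using U V by (intro Bochner_Integration.integral_add) (simp_all add: L2_fun_def)
      finally show ?thesis unfolding U2 V2 .
    qed
    then show "\<forall>\<^sub>F p in sequentially \<times>\<^sub>F sequentially. norm (\<integral>\<omega>. ?U (fst p) \<omega> * ?V (snd p) \<omega> \<partial>M)
        \<le> norm (sq_dist \<mu> k (f (fst p)) + sq_dist \<nu> l (g (snd p))) * 1"
      by (intro always_eventually allI) (simp add: sq_dist_nonneg)
  qed
  have expand: "(\<integral>\<omega>. f m (X \<omega>) * g n (Y \<omega>) \<partial>M) = (\<integral>\<omega>. ?U m \<omega> * ?V n \<omega> \<partial>M)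
      + (\<integral>\<omega>. ?U m \<omega> * l (Y \<omega>) \<partial>M) + (\<integral>\<omega>. ?V n \<omega> * k (X \<omega>) \<partial>M) + (\<integral>\<omega>. k (X \<omega>) * l (Y \<omega>) \<partial>M)" for m n
  proof -
    have "f m (X \<omega>) * g n (Y \<omega>) = ?U m \<omega> * ?V n \<omega> + ?U m \<omega> * l (Y \<omega>) + ?V n \<omega> * k (X \<omega>)
        + k (X \<omega>) * l (Y \<omega>)" for \<omega>
      by (simp add: algebra_simps)
    then have "(\<integral>\<omega>. f m (X \<omega>) * g n (Y \<omega>) \<partial>M) = (\<integral>\<omega>. ?U m \<omega> * ?V n \<omega> + ?U m \<omega> * l (Y \<omega>)
        + ?V n \<omega> * k (X \<omega>) + k (X \<omega>) * l (Y \<omega>) \<partial>M)"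
      by (intro Bochner_Integration.integral_cong) simp_all
    also have "\<dots> = (\<integral>\<omega>. ?U m \<omega> * ?V n \<omega> \<partial>M)
      + (\<integral>\<omega>. ?U m \<omega> * l (Y \<omega>) \<partial>M) + (\<integral>\<omega>. ?V n \<omega> * k (X \<omega>) \<partial>M) + (\<integral>\<omega>. k (X \<omega>) * l (Y \<omega>) \<partial>M)"
      using L2_fun_mult_integrable[OF U V, of m n] L2_fun_mult_integrable[OF U lM, of m]
        L2_fun_mult_integrable[OF V kM, of n] L2_fun_mult_integrable[OF kM lM]
      by (subst Bochner_Integration.integral_add, simp, simp)+ simp
    finally show ?thesis .
  qed
  have "((\<lambda>p. (\<integral>\<omega>. ?U (fst p) \<omega> * ?V (snd p) \<omega> \<partial>M)
      + (\<integral>\<omega>. ?U (fst p) \<omega> * l (Y \<omega>) \<partial>M) + (\<integral>\<omega>. ?V (snd p) \<omega> * k (X \<omega>) \<partial>M)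
      + (\<integral>\<omega>. k (X \<omega>) * l (Y \<omega>) \<partial>M)) \<longlongrightarrow> 0 + 0 + 0 + (\<integral>\<omega>. k (X \<omega>) * l (Y \<omega>) \<partial>M))
      (sequentially \<times>\<^sub>F sequentially)"
    by (intro tendsto_add T3 filterlim_compose[OF T1 fst_lim] filterlim_compose[OF T2 snd_lim] tendsto_const)
  then show ?thesis unfolding expand split_beta' by simp
qed

end

section \<open>Coefficients and convergence for a given joint density\<close>

locale joint_density_rvs = two_rvs +
  fixes c :: "real \<times> real \<Rightarrow> real"
  assumes jd: "joint_density M X Y c"
begin

lemma c_measurable [measurable]: "c \<in> borel_measurable (borel \<Otimes>\<^sub>M borel)"
  using jd by (simp add: joint_density_def)

text \<open>For bounded \<open>h\<close> the integral against \<open>c\<close> is the expectation of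
  a bounded variable, so it exists even when \<open>c\<close> is not square integrable.\<close>

lemma density_integral:
  assumes [measurable]: "h \<in> borel_measurable (borel \<Otimes>\<^sub>M borel)" and "\<And>z. \<bar>h z\<bar> \<le> C"
  shows "integrable (\<mu> \<Otimes>\<^sub>M \<nu>) (\<lambda>z. c z * h z)"
    and "(\<integral>z. c z * h z \<partial>(\<mu> \<Otimes>\<^sub>M \<nu>)) = (\<integral>\<omega>. h (X \<omega>, Y \<omega>) \<partial>M)"
proof -
  have pos: "AE z in \<mu> \<Otimes>\<^sub>M \<nu>. 0 \<le> c z"
    and eq: "distr M (borel \<Otimes>\<^sub>M borel) (\<lambda>\<omega>. (X \<omega>, Y \<omega>)) = density (\<mu> \<Otimes>\<^sub>M \<nu>) (\<lambda>z. ennreal (c z))"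
    using jd by (simp_all add: joint_density_def)
  have "integrable M (\<lambda>\<omega>. h (X \<omega>, Y \<omega>))"
    using assms by (intro integrable_const_bound[where B=C]) auto
  then have "integrable (distr M (borel \<Otimes>\<^sub>M borel) (\<lambda>\<omega>. (X \<omega>, Y \<omega>))) h"
    by (subst integrable_distr_eq) auto
  then show "integrable (\<mu> \<Otimes>\<^sub>M \<nu>) (\<lambda>z. c z * h z)"
    unfolding eq using pos by (subst (asm) integrable_density) auto
  have "(\<integral>\<omega>. h (X \<omega>, Y \<omega>) \<partial>M) = (\<integral>z. h z \<partial>distr M (borel \<Otimes>\<^sub>M borel) (\<lambda>\<omega>. (X \<omega>, Y \<omega>)))"
    by (subst integral_distr) auto
  also have "\<dots> = (\<integral>z. c z * h z \<partial>(\<mu> \<Otimes>\<^sub>M \<nu>))"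
    unfolding eq using pos by (subst integral_density) auto
  finally show "(\<integral>z. c z * h z \<partial>(\<mu> \<Otimes>\<^sub>M \<nu>)) = (\<integral>\<omega>. h (X \<omega>, Y \<omega>) \<partial>M)" ..
qed

lemma density_tensor_integral:
  shows "integrable (\<mu> \<Otimes>\<^sub>M \<nu>) (\<lambda>z. c z * tensor_score (j, k) z)"
    and "(\<integral>z. c z * tensor_score (j, k) z \<partial>(\<mu> \<Otimes>\<^sub>M \<nu>)) = LP_comoment M j k X Y"
proof -
  obtain C where "\<And>z. \<bar>tensor_score (j, k) z\<bar> \<le> C" using tensor_score_bounded by blast
  from density_integral[OF tensor_score_measurable this]
  show "integrable (\<mu> \<Otimes>\<^sub>M \<nu>) (\<lambda>z. c z * tensor_score (j, k) z)"
    "(\<integral>z. c z * tensor_score (j, k) z \<partial>(\<mu> \<Otimes>\<^sub>M \<nu>)) = LP_comoment M j k X Y"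
    by (simp_all only: LP_comoment_eq_tensor)
qed

text \<open>Subtracting 1 changes only the coefficient at \<open>(0, 0)\<close>, from 1 to 0; the
  other coefficients with an index 0 vanish already by \<open>LP_comoment_zero\<close>.\<close>

lemma coefficient_integral:
  assumes "j \<in> J" "k \<in> K"
  shows "integrable (\<mu> \<Otimes>\<^sub>M \<nu>) (\<lambda>z. (c z - 1) * tensor_score (j, k) z)"
    and "(\<integral>z. (c z - 1) * tensor_score (j, k) z \<partial>(\<mu> \<Otimes>\<^sub>M \<nu>))
      = (if j > 0 \<and> k > 0 then LP_comoment M j k X Y else 0)"
proof -
  have t: "integrable (\<mu> \<Otimes>\<^sub>M \<nu>) (tensor_score (j, k))"
    using L2_fun_mult_integrable[OF L2_const[of 1] tensor_score_L2] by simp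
  have eq: "(c z - 1) * tensor_score (j, k) z = c z * tensor_score (j, k) z - tensor_score (j, k) z" for z
    by (simp add: algebra_simps)
  show "integrable (\<mu> \<Otimes>\<^sub>M \<nu>) (\<lambda>z. (c z - 1) * tensor_score (j, k) z)"
    unfolding eq by (intro Bochner_Integration.integrable_diff density_tensor_integral t)
  have "(\<integral>z. (c z - 1) * tensor_score (j, k) z \<partial>(\<mu> \<Otimes>\<^sub>M \<nu>))
      = LP_comoment M j k X Y - (if (j, k) = (0, 0) then 1 else 0)"
    unfolding eq using assms
    by (subst Bochner_Integration.integral_diff)
      (simp_all only: density_tensor_integral t tensor_score_integral mem_Sigma_iff simp_thms)
  also have "\<dots> = (if j > 0 \<and> k > 0 then LP_comoment M j k X Y else 0)"
    using LP_comoment_zero[OF assms] by (cases "j = 0"; cases "k = 0") auto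
  finally show "(\<integral>z. (c z - 1) * tensor_score (j, k) z \<partial>(\<mu> \<Otimes>\<^sub>M \<nu>))
      = (if j > 0 \<and> k > 0 then LP_comoment M j k X Y else 0)" .
qed

text \<open>Completeness concerns all of \<open>J \<times> K\<close>; the pairs with an index 0 drop
  out of the sum because their coefficients are 0.\<close>

lemma L2_series:
  assumes "L2_fun (\<mu> \<Otimes>\<^sub>M \<nu>) (\<lambda>z. c z - 1)"
  shows "((\<lambda>F. sq_dist (\<mu> \<Otimes>\<^sub>M \<nu>) (\<lambda>z. c z - 1)
      (\<lambda>z. \<Sum>(j, k)\<in>F. LP_comoment M j k X Y * tensor_score (j, k) z)) \<longlongrightarrow> 0)
    (finite_subsets_at_top ((J - {0}) \<times> (K - {0})))"
proof -
  interpret orthonormal_family "\<mu> \<Otimes>\<^sub>M \<nu>" tensor_score "J \<times> K" by (rule orthonormal_tensor)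
  interpret D: dense_indicators "\<mu> \<Otimes>\<^sub>M \<nu>" tensor_score "J \<times> K" by (rule dense_tensor)
  let ?I = "(J - {0}) \<times> (K - {0})"
  let ?c = "\<lambda>i. \<integral>z. (c z - 1) * tensor_score i z \<partial>(\<mu> \<Otimes>\<^sub>M \<nu>)"
  have "((\<lambda>F. sq_dist (\<mu> \<Otimes>\<^sub>M \<nu>) (\<lambda>z. c z - 1) (\<lambda>z. \<Sum>i\<in>F. ?c i * tensor_score i z)) \<longlongrightarrow> 0)
      (finite_subsets_at_top ?I)"
  proof (rule fourier_series_converges[OF D.L2_in_closure[OF assms]])
    show "?c i = 0" if "i \<in> J \<times> K - ?I" for i
      using that coefficient_integral(2)[of "fst i" "snd i"] by (cases i) auto
  qed auto
  moreover have "\<forall>\<^sub>F F in finite_subsets_at_top ?I.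
      sq_dist (\<mu> \<Otimes>\<^sub>M \<nu>) (\<lambda>z. c z - 1) (\<lambda>z. \<Sum>i\<in>F. ?c i * tensor_score i z)
      = sq_dist (\<mu> \<Otimes>\<^sub>M \<nu>) (\<lambda>z. c z - 1)
          (\<lambda>z. \<Sum>(j, k)\<in>F. LP_comoment M j k X Y * tensor_score (j, k) z)"
  proof (rule eventually_finite_subsets_at_top_weakI)
    fix F assume F: "finite F" "F \<subseteq> ?I"
    have "(\<Sum>i\<in>F. ?c i * tensor_score i z)
        = (\<Sum>(j, k)\<in>F. LP_comoment M j k X Y * tensor_score (j, k) z)" for z
      using F(2) by (intro sum.cong) (auto simp: coefficient_integral(2) subset_iff)
    then show "sq_dist (\<mu> \<Otimes>\<^sub>M \<nu>) (\<lambda>z. c z - 1) (\<lambda>z. \<Sum>i\<in>F. ?c i * tensor_score i z)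
      = sq_dist (\<mu> \<Otimes>\<^sub>M \<nu>) (\<lambda>z. c z - 1)
          (\<lambda>z. \<Sum>(j, k)\<in>F. LP_comoment M j k X Y * tensor_score (j, k) z)" by simp
  qed
  ultimately show ?thesis by (rule Lim_transform_eventually)
qed

text \<open>A pair of atoms has positive product measure, so \<open>c\<close> has a definite value
  there: \<open>Pr[X = x, Y = y]\<close> divided by the product of the marginal probabilities, which
  is the expectation of the product of the normalized indicators.\<close>

lemma pointwise_series:
  assumes "measure \<mu> {x} \<noteq> 0" "measure \<nu> {y} \<noteq> 0" "x = quantile M X u" "y = quantile M Y v"
  shows "((\<lambda>(m, n). \<Sum>j \<in> J \<inter> {1..m}. \<Sum>k \<in> K \<inter> {1..n}.
      LP_comoment M j k X Y * quantile_score M X j u * quantile_score M Y k v)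
    \<longlongrightarrow> c (x, y) - 1) (sequentially \<times>\<^sub>F sequentially)"
proof -
  let ?p = "measure \<mu> {x}" and ?q = "measure \<nu> {y}"
  let ?k = "\<lambda>t. indicator {x} t / ?p" and ?l = "\<lambda>t. indicator {y} t / ?q"
  have "((\<lambda>(m, n). \<integral>\<omega>. RX.score_kernel x m (X \<omega>) * RY.score_kernel y n (Y \<omega>) \<partial>M)
      \<longlongrightarrow> (\<integral>\<omega>. ?k (X \<omega>) * ?l (Y \<omega>) \<partial>M)) (sequentially \<times>\<^sub>F sequentially)"
  proof (rule expectation_product_tendsto[where A="1 / ?p" and B="1 / ?q"])
    show "(\<lambda>m. sq_dist \<mu> ?k (RX.score_kernel x m)) \<longlonglongrightarrow> 0"
      by (rule RX.score_kernel_tendsto) fact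
    show "(\<lambda>n. sq_dist \<nu> ?l (RY.score_kernel y n)) \<longlonglongrightarrow> 0"
      by (rule RY.score_kernel_tendsto) fact
  qed (auto simp: RX.score_kernel_L2 RY.score_kernel_L2 indicator_def)
  moreover have "(\<integral>\<omega>. ?k (X \<omega>) * ?l (Y \<omega>) \<partial>M) = c (x, y)"
  proof -
    let ?h = "\<lambda>z. indicator {(x, y)} z / (?p * ?q)"
    have S: "{(x, y)} \<in> sets (borel \<Otimes>\<^sub>M borel)"
      using pair_measureI[of "{x}" borel "{y}" borel] by simp
    have "(\<integral>\<omega>. ?k (X \<omega>) * ?l (Y \<omega>) \<partial>M) = (\<integral>\<omega>. ?h (X \<omega>, Y \<omega>) \<partial>M)"
      by (intro Bochner_Integration.integral_cong) (auto simp: indicator_def)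
    also have "\<dots> = (\<integral>z. c z * ?h z \<partial>(\<mu> \<Otimes>\<^sub>M \<nu>))"
      by (rule density_integral(2)[symmetric, where C="1 / (?p * ?q)"])
        (use S in \<open>auto simp: indicator_def\<close>)
    also have "\<dots> = (\<integral>z. c (x, y) / (?p * ?q) * indicator {(x, y)} z \<partial>(\<mu> \<Otimes>\<^sub>M \<nu>))"
      by (intro Bochner_Integration.integral_cong) (auto simp: indicator_def)
    also have "\<dots> = c (x, y) / (?p * ?q) * measure (\<mu> \<Otimes>\<^sub>M \<nu>) {(x, y)}"
      by (subst integral_mult_right_zero) (simp add: space_pair_measure)
    also have "measure (\<mu> \<Otimes>\<^sub>M \<nu>) {(x, y)} = ?p * ?q"
    proof -
      have "{(x, y)} = {x} \<times> {y}" by simp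
      then show ?thesis
        by (simp only: measure_def nu.emeasure_pair_measure_Times[of "{x}" \<mu> "{y}"] sets_distr
          borel_singleton sets.empty_sets enn2real_mult)
    qed
    finally show ?thesis using assms by simp
  qed
  ultimately show ?thesis
    unfolding score_kernel_sum[OF assms(3,4)] split_beta' by (intro tendsto_diff) auto
qed

lemma square_integrable_iff:
  "integrable (\<mu> \<Otimes>\<^sub>M \<nu>) (\<lambda>z. (c z)\<^sup>2) \<longleftrightarrow> L2_fun (\<mu> \<Otimes>\<^sub>M \<nu>) (\<lambda>z. c z - 1)"
proof -
  have "integrable (\<mu> \<Otimes>\<^sub>M \<nu>) (\<lambda>z. (c z)\<^sup>2) \<longleftrightarrow> L2_fun (\<mu> \<Otimes>\<^sub>M \<nu>) c"
    by (simp add: L2_fun_def)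
  also have "\<dots> \<longleftrightarrow> L2_fun (\<mu> \<Otimes>\<^sub>M \<nu>) (\<lambda>z. c z - 1)"
    using L2_fun_diff[OF _ L2_const[of 1], of c] L2_fun_add[OF _ L2_const[of 1], of "\<lambda>z. c z - 1"] by auto
  finally show ?thesis .
qed

end

text \<open>Where versions are determined only almost everywhere, convergence is meant in mean
  square; single values are compared only at atoms. The restriction to atoms matters even for
  discrete variables: a quantile can be a limit of atoms without being one, and there the defining
  quotient is a division by zero.\<close>

theorem theorem19:
  fixes M :: "'a measure" and X Y :: "'a \<Rightarrow> real"
    and cop dY dX :: "real \<Rightarrow> real \<Rightarrow> real"
  assumes "prob_space M"
    and "X \<in> borel_measurable M" and "Y \<in> borel_measurable M"
    and "is_copula_density M X Y dY dX cop"
  defines "J \<equiv> score_index M X" and "K \<equiv> score_index M Y"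
  shows
    \<comment> \<open>the series, in the mean-square sense\<close>
    "(set_integrable lborel unit_square (\<lambda>(u, v). (cop u v)\<^sup>2) \<longleftrightarrow>
      has_L2_sum
        (\<lambda>(j, k) (u, v). LP_comoment M j k X Y * quantile_score M X j u * quantile_score M Y k v)
        ((J - {0}) \<times> (K - {0}))
        (\<lambda>(u, v). cop u v - 1))
    \<comment> \<open>the series, pointwise, for discrete variables\<close>
   \<and> (discrete_rv M X \<and> discrete_rv M Y \<longrightarrow>
      (\<forall>u v. 0 < u \<and> u < 1 \<and> 0 < v \<and> v < 1
          \<and> \<P>(\<omega> in M. X \<omega> = quantile M X u) \<noteq> 0 \<and> \<P>(\<omega> in M. Y \<omega> = quantile M Y v) \<noteq> 0 \<longrightarrow>
        ((\<lambda>(m, n). \<Sum>j \<in> J \<inter> {1..m}. \<Sum>k \<in> K \<inter> {1..n}.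
            LP_comoment M j k X Y * quantile_score M X j u * quantile_score M Y k v)
          \<longlongrightarrow> cop u v - 1) (sequentially \<times>\<^sub>F sequentially)))
    \<comment> \<open>the series, as an orthogonal expansion: the coefficients of \<open>cop - 1\<close>\<close>
   \<and> (\<forall>j\<in>J. \<forall>k\<in>K.
        set_integrable lborel unit_square
          (\<lambda>(u, v). (cop u v - 1) * quantile_score M X j u * quantile_score M Y k v) \<and>
        (LINT (u, v):unit_square|lborel.
           (cop u v - 1) * quantile_score M X j u * quantile_score M Y k v)
          = (if j > 0 \<and> k > 0 then LP_comoment M j k X Y else 0))
    \<comment> \<open>the equivalent integral form\<close>
   \<and> (\<forall>j \<in> J - {0}. \<forall>k \<in> K - {0}.
        set_integrable lborel unit_square
          (\<lambda>(u, v). dY v (quantile M X u) * quantile_score M X j u * quantile_score M Y k v) \<and>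
        (LINT (u, v):unit_square|lborel.
           dY v (quantile M X u) * quantile_score M X j u * quantile_score M Y k v)
          = LP_comoment M j k X Y)"
proof -
  interpret two_rvs M X Y
    using assms(1-3) by (simp add: two_rvs_def two_rvs_axioms_def)
  obtain c where jd: "joint_density M X Y c" and cop: "\<And>u v. 0 < u \<Longrightarrow> u < 1 \<Longrightarrow> 0 < v \<Longrightarrow> v < 1 \<Longrightarrow>
      cop u v = c (quantile M X u, quantile M Y v)"
    using copula_joint_density[OF two_rvs_axioms assms(4)] by blast
  interpret joint_density_rvs M X Y c
    by unfold_locales (rule jd)
  have dY: "dY v (quantile M X u) = c (quantile M X u, quantile M Y v)"
    if "0 < u" "u < 1" "0 < v" "v < 1" for u v
    using that cop[OF that] assms(4) by (simp add: is_copula_density_def)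
  let ?P = "\<mu> \<Otimes>\<^sub>M \<nu>" and ?I = "(J - {0}) \<times> (K - {0})"
  let ?f = "\<lambda>(j, k) (u, v). LP_comoment M j k X Y * quantile_score M X j u * quantile_score M Y k v"
  let ?s = "\<lambda>F z. \<Sum>(j, k)\<in>F. LP_comoment M j k X Y * tensor_score (j, k) z"
  have sm: "?s F \<in> borel_measurable (borel \<Otimes>\<^sub>M borel)" for F
    by (simp add: split_beta')
  have "set_integrable lborel unit_square (\<lambda>(u, v). (cop u v)\<^sup>2) \<longleftrightarrow> integrable ?P (\<lambda>z. (c z)\<^sup>2)"
    by (rule set_integrable_unit_square) (auto simp: cop)
  then have sq: "set_integrable lborel unit_square (\<lambda>(u, v). (cop u v)\<^sup>2) \<longleftrightarrow> L2_fun ?P (\<lambda>z. c z - 1)"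
    by (simp only: square_integrable_iff)
  \<comment> \<open>The distance is kept as a nonnegative integral, which is infinite, not 0, when
    the square is not integrable; the converse direction of the equivalence depends on this.\<close>
  have nn: "(\<integral>\<^sup>+z\<in>unit_square. ennreal (((\<lambda>(u, v). cop u v - 1) z - (\<Sum>i\<in>F. ?f i z))\<^sup>2) \<partial>lborel)
      = (\<integral>\<^sup>+z. ennreal ((c z - 1 - ?s F z)\<^sup>2) \<partial>?P)" for F
  proof (rule nn_integral_unit_square)
    show "(\<lambda>z. (c z - 1 - ?s F z)\<^sup>2) \<in> borel_measurable (borel \<Otimes>\<^sub>M borel)"
      using sm[of F] by simp
    show "((\<lambda>(u, v). cop u v - 1) (u, v) - (\<Sum>i\<in>F. ?f i (u, v)))\<^sup>2
      = (c (quantile M X u, quantile M Y v) - 1 - ?s F (quantile M X u, quantile M Y v))\<^sup>2"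
      if "0 < u" "u < 1" "0 < v" "v < 1" for u v
      using that by (simp add: cop split_beta' tensor_score_def quantile_score_def mult.assoc)
  qed
  have sL: "L2_fun ?P (?s F)" for F
    by (simp add: split_beta') (intro L2_fun_sum L2_fun_cmult tensor_score_L2)
  have part1: "set_integrable lborel unit_square (\<lambda>(u, v). (cop u v)\<^sup>2)
      \<longleftrightarrow> has_L2_sum ?f ?I (\<lambda>(u, v). cop u v - 1)"
  proof
    assume "set_integrable lborel unit_square (\<lambda>(u, v). (cop u v)\<^sup>2)"
    then have L: "L2_fun ?P (\<lambda>z. c z - 1)" by (simp only: sq)
    have "(\<integral>\<^sup>+z. ennreal ((c z - 1 - ?s F z)\<^sup>2) \<partial>?P) = ennreal (sq_dist ?P (\<lambda>z. c z - 1) (?s F))" for F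
      unfolding sq_dist_def by (rule nn_integral_eq_integral) (auto intro: sq_dist_integrable[OF L sL])
    then show "has_L2_sum ?f ?I (\<lambda>(u, v). cop u v - 1)"
      unfolding has_L2_sum_def nn using tendsto_ennrealI[OF L2_series[OF L]]
      by (simp add: J_def K_def)
  next
    \<comment> \<open>A convergent series has some partial sum at finite distance; the partial sum
      is bounded and so square integrable, hence so is \<open>cop - 1\<close>.\<close>
    assume "has_L2_sum ?f ?I (\<lambda>(u, v). cop u v - 1)"
    then have "\<forall>\<^sub>F F in finite_subsets_at_top ?I. (\<integral>\<^sup>+z. ennreal ((c z - 1 - ?s F z)\<^sup>2) \<partial>?P) < 1"
      unfolding has_L2_sum_def nn by (rule order_tendstoD) simp
    then obtain F where F: "(\<integral>\<^sup>+z. ennreal ((c z - 1 - ?s F z)\<^sup>2) \<partial>?P) < 1"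
      using eventually_happens'[OF finite_subsets_at_top_neq_bot] by blast
    have "(\<lambda>z. c z - 1 - ?s F z) \<in> borel_measurable ?P"
      using sm[of F] by simp
    moreover from this have "integrable ?P (\<lambda>z. (c z - 1 - ?s F z)\<^sup>2)"
      using F by (intro integrableI_bounded) (auto intro: order.strict_trans)
    ultimately have "L2_fun ?P (\<lambda>z. c z - 1 - ?s F z)"
      by (simp add: L2_fun_def)
    from L2_fun_add[OF this sL[of F]] have "L2_fun ?P (\<lambda>z. c z - 1)" by simp
    then show "set_integrable lborel unit_square (\<lambda>(u, v). (cop u v)\<^sup>2)" by (simp only: sq)
  qed
  have part2: "((\<lambda>(m, n). \<Sum>j \<in> J \<inter> {1..m}. \<Sum>k \<in> K \<inter> {1..n}.
            LP_comoment M j k X Y * quantile_score M X j u * quantile_score M Y k v)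
          \<longlongrightarrow> cop u v - 1) (sequentially \<times>\<^sub>F sequentially)"
    if "0 < u" "u < 1" "0 < v" "v < 1" "\<P>(\<omega> in M. X \<omega> = quantile M X u) \<noteq> 0"
      "\<P>(\<omega> in M. Y \<omega> = quantile M Y v) \<noteq> 0" for u v
  proof -
    have "\<P>(\<omega> in M. X \<omega> = x) = measure \<mu> {x}" "\<P>(\<omega> in M. Y \<omega> = x) = measure \<nu> {x}" for x
      by (simp_all add: measure_distr vimage_def Int_def conj_commute)
    then show ?thesis
      using pointwise_series[OF _ _ refl refl, of u v] that by (simp add: cop J_def K_def)
  qed
  have part3: "set_integrable lborel unit_square
        (\<lambda>(u, v). (cop u v - 1) * quantile_score M X j u * quantile_score M Y k v)"
      "(LINT (u, v):unit_square|lborel. (cop u v - 1) * quantile_score M X j u * quantile_score M Y k v)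
        = (if j > 0 \<and> k > 0 then LP_comoment M j k X Y else 0)"
    if "j \<in> J" "k \<in> K" for j k
  proof -
    let ?h = "\<lambda>z. (c z - 1) * tensor_score (j, k) z"
    let ?F = "\<lambda>(u, v). (cop u v - 1) * quantile_score M X j u * quantile_score M Y k v"
    have h: "?h \<in> borel_measurable (borel \<Otimes>\<^sub>M borel)" by measurable
    have F: "?F (u, v) = ?h (quantile M X u, quantile M Y v)"
      if "0 < u" "u < 1" "0 < v" "v < 1" for u v
      using that by (simp add: cop tensor_score_def quantile_score_def mult.assoc)
    note ci = coefficient_integral[OF that[unfolded J_def K_def]]
    show "set_integrable lborel unit_square ?F"
      using set_integrable_unit_square[where F="?F", OF h F] ci(1) by blast
    show "(LINT (u, v):unit_square|lborel. (cop u v - 1) * quantile_score M X j u * quantile_score M Y k v)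
        = (if j > 0 \<and> k > 0 then LP_comoment M j k X Y else 0)"
      using set_integral_unit_square[where F="?F", OF h F] ci(2) by (simp add: split_beta')
  qed
  have part4: "set_integrable lborel unit_square
        (\<lambda>(u, v). dY v (quantile M X u) * quantile_score M X j u * quantile_score M Y k v)"
      "(LINT (u, v):unit_square|lborel.
         dY v (quantile M X u) * quantile_score M X j u * quantile_score M Y k v)
        = LP_comoment M j k X Y" for j k
  proof -
    let ?h = "\<lambda>z. c z * tensor_score (j, k) z"
    let ?F = "\<lambda>(u, v). dY v (quantile M X u) * quantile_score M X j u * quantile_score M Y k v"
    have h: "?h \<in> borel_measurable (borel \<Otimes>\<^sub>M borel)" by measurable
    have F: "?F (u, v) = ?h (quantile M X u, quantile M Y v)"
      if "0 < u" "u < 1" "0 < v" "v < 1" for u v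
      using that by (simp add: dY tensor_score_def quantile_score_def mult.assoc)
    show "set_integrable lborel unit_square ?F"
      using set_integrable_unit_square[where F="?F", OF h F] density_tensor_integral(1) by blast
    show "(LINT (u, v):unit_square|lborel.
         dY v (quantile M X u) * quantile_score M X j u * quantile_score M Y k v)
        = LP_comoment M j k X Y"
      using set_integral_unit_square[where F="?F", OF h F] density_tensor_integral(2)
      by (simp add: split_beta')
  qed
  show ?thesis
    using part1 part2 part3 part4 by blast
qed

end
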